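(* Let $\mathbf K$ be as in the context and let $\downarrow$ be a simple independence relation in $\mathbf K$ with the $(<\aleph_0)$-witness property for singletons. Then the following are equivalent: (1) $\downarrow$ is a supersimple independence relation; (2) for every $M\in\mathbf K$ and every $p\in\mathbf S(M)$, $U(p)<\infty$.
   Context: $\mathbf{K}$ is an abstract elementary class (AEC) with strong substructure relation $\le_{\mathbf K}$ and Löwenheim–Skolem–Tarski number $\operatorname{LS}(\mathbf K)$, with joint embedding, amalgamation and no maximal models; we work in a monster model $\mathfrak C$. Galois-types $\mathbf{tp}(\mathbf b/A)$ are orbits of $\mathbf b$ under automorphisms of $\mathfrak C$ fixing $A$ pointwise; $\mathbf S^\alpha(M)$, $\mathbf S^\alpha(A)$ are the sets of Galois-types of length $\alpha$ over $M$, $A$; $\mathbf S(M)=\mathbf S^1(M)$, $\mathbf S^{<\infty}=\bigcup_\alpha\mathbf S^\alpha$. An independence relation is a relation $A\downarrow_M B$ ($M\le_{\mathbf K}\mathfrak C$, $A,B\subseteq\mathfrak C$) satisfying: invariance under automorphisms of $\mathfrak C$; monotonicity; normality ($A\downarrow_MB$ iff $A\cup M\downarrow_MB\cup M$); base monotonicity (if $A\downarrow_MB$, $M\le_{\mathbf K}N$, $|N|\subseteq B$ then $A\downarrow_NB$); existence (every $p\in\mathbf S^{<\infty}(M)$ has, for each $N\ge_{\mathbf K}M$, an extension in $\mathbf S^{<\infty}(N)$ not forking over $M$); transitivity (if $M\le_{\mathbf K}N$, $A\downarrow_MN$, $A\downarrow_NB$ then $A\downarrow_MB$). "$\mathbf{tp}(\bar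 a/B)$ does not fork over $M$" means $\mathrm{ran}(\bar a)\downarrow_MB$; for $p\in\mathbf S(M)$, $q\in\mathbf S(N)$, $M\le_{\mathbf K}N$, $q$ is a forking extension of $p$ if $q$ extends $p$ and forks over $M$. A simple independence relation additionally satisfies symmetry ($A\downarrow_MB$ iff $B\downarrow_MA$); type-amalgamation (if $p\in\mathbf S^{<\infty}(M)$, $M\subseteq A,B$, $A\downarrow_MB$, $N^*\in\mathbf K$ contains $A\cup B$, and $q_1\in\mathbf S^{<\infty}(A)$, $q_2\in\mathbf S^{<\infty}(B)$ both extend $p$ and do not fork over $M$, then some $q\in\mathbf S^{<\infty}(N^* )$ extends $q_1,q_2$ and does not fork over $M$); uniform local character (there are cardinals $\lambda,\theta$ such that every $p\in\mathbf S^\alpha(M)$ does not fork over some $M_0\le_{\mathbf K}M$ with $\|M_0\|\le\lambda+\alpha^{<\theta}$). It is supersimple if moreover it has finite local character: for every limit ordinal $\delta$, every $\le_{\mathbf K}$-increasing continuous chain $\{M_i:i\le\delta\}$ and every $p\in\mathbf S(M_\delta)$, there is $i<\delta$ with $p$ not forking over $M_i$. The $(<\aleph_0)$-witness property for singletons: for all $M\le_{\mathbf K}N$ and $b\in\mathfrak C$, $b\downarrow_MN$ iff $b\downarrow_MA$ for every finite $A\subseteq N$. $U$-rank: for $p\in\mathbf S(M)$, $U(p)\ge0$; for limit $\alpha$, $U(p)\ge\alpha$ iff $U(p)\ge\beta$ for all $\beta<\alpha$; $U(p)\ge\beta+1$ iff there are $M'\ge_{\mathbf K}M$ with $\|M'\|=\|M\|$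 and $p'\in\mathbf S(M')$ a forking extension of $p$ with $U(p')\ge\beta$; $U(p)=\alpha$ iff $U(p)\ge\alpha$ and not $U(p)\ge\alpha+1$; $U(p)=\infty$ iff $U(p)\ge\alpha$ for every ordinal $\alpha$. *)

theory Defs
  imports Main
begin

unbundle cardinal_syntax

text \<open>
  Conventions.

  The elements of all structures live in one type \<open>'a\<close>, so a class of models is a set of structures
  with universe contained in \<open>'a\<close>. Ordinals are the elements of a well-ordered type \<open>'o\<close>: \<open>\<alpha> :: 'o\<close>
  stands for the order type of \<open>{..<\<alpha>}\<close>. Statements that quantify over all ordinals carry the
  argument \<open>TYPE('o)\<close>; they mean what they should as soon as \<open>'o\<close> has more than \<open>2\<^bsup>|'a|\<^esup>\<close> elements,
  which bounds the number of pairs (model, type), hence the ordinals that are values of the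
  rank and the lengths of strictly increasing chains.

  As usual with a monster model \<open>\<CC>\<close>, ``small'' means of cardinality less than that of \<open>\<CC>\<close>; models are
  small strong submodels of \<open>\<CC>\<close>, and parameter sets and tuples are small.
\<close>

section \<open>Structures\<close>

record ('f, 'r) language =
  funs :: "'f set"
  rels :: "'r set"
  farity :: "'f \<Rightarrow> nat"
  rarity :: "'r \<Rightarrow> nat"

record ('f, 'r, 'a) struc =
  uni :: "'a set"
  fint :: "'f \<Rightarrow> 'a list \<Rightarrow> 'a"
  rint :: "'r \<Rightarrow> 'a list \<Rightarrow> bool"

text \<open>Interpretations have fixed values outside their domain, so that equality of records is
  equality of structures.\<close>

definition is_struc :: "('f, 'r) language \<Rightarrow> ('f, 'r, 'a) struc \<Rightarrow> bool" where
  "is_struc L M \<longleftrightarrow>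
     uni M \<noteq> {} \<and>
     (\<forall>f xs. if f \<in> funs L \<and> set xs \<subseteq> uni M \<and> length xs = farity L f
             then fint M f xs \<in> uni M else fint M f xs = undefined) \<and>
     (\<forall>r xs. rint M r xs \<longrightarrow> r \<in> rels L \<and> set xs \<subseteq> uni M \<and> length xs = rarity L r)"

definition substruc ::
  "('f, 'r) language \<Rightarrow> ('f, 'r, 'a) struc \<Rightarrow> ('f, 'r, 'a) struc \<Rightarrow> bool" where
  "substruc L M N \<longleftrightarrow>
     is_struc L M \<and> is_struc L N \<and> uni M \<subseteq> uni N \<and>
     (\<forall>f\<in>funs L. \<forall>xs. set xs \<subseteq> uni M \<and> length xs = farity L f \<longrightarrow> fint M f xs = fint N f xs) \<and>
     (\<forall>r\<in>rels L. \<forall>xs. set xs \<subseteq> uni M \<and> length xs = rarity L r \<longrightarrow> (rint M r xs \<longleftrightarrow> rint N r xs))"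

definition struc_iso ::
  "('f, 'r) language \<Rightarrow> ('a \<Rightarrow> 'a) \<Rightarrow> ('f, 'r, 'a) struc \<Rightarrow> ('f, 'r, 'a) struc \<Rightarrow> bool" where
  "struc_iso L h M N \<longleftrightarrow>
     is_struc L M \<and> is_struc L N \<and> bij_betw h (uni M) (uni N) \<and>
     (\<forall>f\<in>funs L. \<forall>xs. set xs \<subseteq> uni M \<and> length xs = farity L f \<longrightarrow>
        h (fint M f xs) = fint N f (map h xs)) \<and>
     (\<forall>r\<in>rels L. \<forall>xs. set xs \<subseteq> uni M \<and> length xs = rarity L r \<longrightarrow>
        (rint M r xs \<longleftrightarrow> rint N r (map h xs)))"

section \<open>Abstract elementary classes\<close>

record ('f, 'r, 'a) aclass =
  lang :: "('f, 'r) language"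
  mods :: "('f, 'r, 'a) struc set"
  leK :: "('f, 'r, 'a) struc \<Rightarrow> ('f, 'r, 'a) struc \<Rightarrow> bool"

definition LS_bound :: "('f, 'r, 'a) aclass \<Rightarrow> 'a rel \<Rightarrow> bool" where
  "LS_bound K \<mu> \<longleftrightarrow>
     Card_order \<mu> \<and> |UNIV :: nat set| \<le>o \<mu> \<and> |funs (lang K)| +c |rels (lang K)| \<le>o \<mu> \<and>
     (\<forall>M\<in>mods K. \<forall>A\<subseteq>uni M. \<exists>N. leK K N M \<and> A \<subseteq> uni N \<and> |uni N| \<le>o |A| +c \<mu>)"

definition LS :: "('f, 'r, 'a) aclass \<Rightarrow> 'a rel" where
  "LS K = (SOME \<mu>. LS_bound K \<mu> \<and> (\<forall>\<nu>. LS_bound K \<nu> \<longrightarrow> \<mu> \<le>o \<nu>))"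

text \<open>In the chain axiom, the range of an increasing chain indexed by an ordinal is given as a set
  of models well-ordered by the strong substructure relation. The structure on the union is
  determined by its universe, since all members of the chain are substructures of it.\<close>

definition is_aec :: "('f, 'r, 'a) aclass \<Rightarrow> bool" where
  "is_aec K \<longleftrightarrow>
     (\<forall>M\<in>mods K. is_struc (lang K) M) \<and>
     partial_order_on (mods K) {(M, N). leK K M N} \<and>
     (\<forall>M N. leK K M N \<longrightarrow> substruc (lang K) M N) \<and>
     (\<forall>M N h. M \<in> mods K \<and> struc_iso (lang K) h M N \<longrightarrow> N \<in> mods K) \<and>
     (\<forall>M N M' N' h. leK K M N \<and> struc_iso (lang K) h N N' \<and> struc_iso (lang K) h M M' \<longrightarrow> leK K M' N') \<and>
     (\<forall>M0 M1 M2. leK K M0 M2 \<and> leK K M1 M2 \<and> uni M0 \<subseteq> uni M1 \<longrightarrow> leK K M0 M1) \<and>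
     (\<forall>\<C>. \<C> \<subseteq> mods K \<and> \<C> \<noteq> {} \<and> well_order_on \<C> {(M, N). M \<in> \<C> \<and> N \<in> \<C> \<and> leK K M N} \<longrightarrow>
        (\<exists>U\<in>mods K. uni U = (\<Union>M\<in>\<C>. uni M) \<and> (\<forall>M\<in>\<C>. leK K M U) \<and>
           (\<forall>N\<in>mods K. (\<forall>M\<in>\<C>. leK K M N) \<longrightarrow> leK K U N))) \<and>
     (\<exists>\<mu>. LS_bound K \<mu>)"

definition K_embedding ::
  "('f, 'r, 'a) aclass \<Rightarrow> ('a \<Rightarrow> 'a) \<Rightarrow> ('f, 'r, 'a) struc \<Rightarrow> ('f, 'r, 'a) struc \<Rightarrow> bool" where
  "K_embedding K h M N \<longleftrightarrow> (\<exists>M'. struc_iso (lang K) h M M' \<and> leK K M' N)"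

definition joint_embedding :: "('f, 'r, 'a) aclass \<Rightarrow> bool" where
  "joint_embedding K \<longleftrightarrow>
     (\<forall>M\<in>mods K. \<forall>N\<in>mods K. \<exists>P\<in>mods K. \<exists>f g. K_embedding K f M P \<and> K_embedding K g N P)"

definition amalgamation :: "('f, 'r, 'a) aclass \<Rightarrow> bool" where
  "amalgamation K \<longleftrightarrow>
     (\<forall>M0 M1 M2. leK K M0 M1 \<and> leK K M0 M2 \<longrightarrow>
        (\<exists>P\<in>mods K. \<exists>f g. K_embedding K f M1 P \<and> K_embedding K g M2 P \<and>
           (\<forall>a\<in>uni M0. f a = g a)))"

text \<open>A model whose universe is all of \<open>'a\<close> has no proper extension inside \<open>'a\<close>, but it may have a
  proper embedding; up to isomorphism this is the same.\<close>

definition no_maximal_models :: "('f, 'r, 'a) aclass \<Rightarrow> bool" where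
  "no_maximal_models K \<longleftrightarrow>
     (\<forall>M\<in>mods K. \<exists>N\<in>mods K. \<exists>f. K_embedding K f M N \<and> f ` uni M \<noteq> uni N)"

section \<open>The monster model and Galois types\<close>

definition automorphism :: "('f, 'r, 'a) aclass \<Rightarrow> ('f, 'r, 'a) struc \<Rightarrow> ('a \<Rightarrow> 'a) \<Rightarrow> bool" where
  "automorphism K C h \<longleftrightarrow> struc_iso (lang K) h C C"

definition small :: "('f, 'r, 'a) struc \<Rightarrow> 'b set \<Rightarrow> bool" where
  "small C A \<longleftrightarrow> |A| <o |uni C|"

definition small_model ::
  "('f, 'r, 'a) aclass \<Rightarrow> ('f, 'r, 'a) struc \<Rightarrow> ('f, 'r, 'a) struc \<Rightarrow> bool" where
  "small_model K C M \<longleftrightarrow> leK K M C \<and> small C (uni M)"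

definition small_subset :: "('f, 'r, 'a) struc \<Rightarrow> 'a set \<Rightarrow> bool" where
  "small_subset C A \<longleftrightarrow> A \<subseteq> uni C \<and> small C A"

text \<open>Larger than the Loewenheim-Skolem-Tarski number, universal for small models, and strongly
  homogeneous for small models.\<close>

definition monster_model :: "('f, 'r, 'a) aclass \<Rightarrow> ('f, 'r, 'a) struc \<Rightarrow> bool" where
  "monster_model K C \<longleftrightarrow>
     C \<in> mods K \<and> LS K <o |uni C| \<and>
     (\<forall>M\<in>mods K. small C (uni M) \<longrightarrow> (\<exists>h. K_embedding K h M C)) \<and>
     (\<forall>M N h. small_model K C M \<and> small_model K C N \<and> struc_iso (lang K) h M N \<longrightarrow>
        (\<exists>g. automorphism K C g \<and> (\<forall>a\<in>uni M. g a = h a)))"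

text \<open>A tuple of length \<open>\<alpha>\<close> is a partial map with domain \<open>{..<\<alpha>}\<close>. A type is an orbit and does not
  determine its domain, which is therefore always passed separately.\<close>

definition gtp ::
  "('f, 'r, 'a) aclass \<Rightarrow> ('f, 'r, 'a) struc \<Rightarrow> ('o \<Rightarrow> 'a option) \<Rightarrow> 'a set \<Rightarrow> ('o \<Rightarrow> 'a option) set"
  where
  "gtp K C b A = {map_option h \<circ> b | h. automorphism K C h \<and> (\<forall>a\<in>A. h a = a)}"

definition gS ::
  "('f, 'r, 'a) aclass \<Rightarrow> ('f, 'r, 'a) struc \<Rightarrow> 'o::wellorder \<Rightarrow> 'a set \<Rightarrow> ('o \<Rightarrow> 'a option) set set"
  where
  "gS K C \<alpha> A = {gtp K C b A | b. dom b = {..<\<alpha>} \<and> ran b \<subseteq> uni C}"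

definition gS_all ::
  "('f, 'r, 'a) aclass \<Rightarrow> ('f, 'r, 'a) struc \<Rightarrow> 'a set \<Rightarrow> ('o::wellorder \<Rightarrow> 'a option) set set" where
  "gS_all K C A = (\<Union>\<alpha>\<in>{\<alpha>. small C {..<\<alpha>}}. gS K C \<alpha> A)"

definition ord_one :: "'o::wellorder" where
  "ord_one = (LEAST \<alpha>. \<exists>\<beta>. \<beta> < \<alpha>)"

abbreviation gS1 ::
  "('f, 'r, 'a) aclass \<Rightarrow> ('f, 'r, 'a) struc \<Rightarrow> 'a set \<Rightarrow> ('o::wellorder \<Rightarrow> 'a option) set set" where
  "gS1 K C A \<equiv> gS K C ord_one A"

definition grestrict ::
  "('f, 'r, 'a) aclass \<Rightarrow> ('f, 'r, 'a) struc \<Rightarrow> ('o \<Rightarrow> 'a option) set \<Rightarrow> 'a set \<Rightarrow>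
     ('o \<Rightarrow> 'a option) set" where
  "grestrict K C q A = (\<Union>b\<in>q. gtp K C b A)"

section \<open>Independence relations\<close>

type_synonym ('f, 'r, 'a) indep = "'a set \<Rightarrow> ('f, 'r, 'a) struc \<Rightarrow> 'a set \<Rightarrow> bool"

text \<open>The type \<open>p\<close> over \<open>B\<close> does not fork over \<open>M\<close>.\<close>

definition nonforking ::
  "('f, 'r, 'a) aclass \<Rightarrow> ('f, 'r, 'a) struc \<Rightarrow> ('f, 'r, 'a) indep \<Rightarrow>
     ('o \<Rightarrow> 'a option) set \<Rightarrow> 'a set \<Rightarrow> ('f, 'r, 'a) struc \<Rightarrow> bool" where
  "nonforking K C ind p B M \<longleftrightarrow> (\<exists>b. p = gtp K C b B \<and> ind (ran b) M B)"

definition ind_invariance ::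
  "('f, 'r, 'a) aclass \<Rightarrow> ('f, 'r, 'a) struc \<Rightarrow> ('f, 'r, 'a) indep \<Rightarrow> bool" where
  "ind_invariance K C ind \<longleftrightarrow>
     (\<forall>h A M B M'. automorphism K C h \<and> small_model K C M \<and> small_subset C A \<and> small_subset C B \<and>
        struc_iso (lang K) h M M' \<and> ind A M B \<longrightarrow> ind (h ` A) M' (h ` B))"

definition ind_monotonicity ::
  "('f, 'r, 'a) aclass \<Rightarrow> ('f, 'r, 'a) struc \<Rightarrow> ('f, 'r, 'a) indep \<Rightarrow> bool" where
  "ind_monotonicity K C ind \<longleftrightarrow>
     (\<forall>A M B A0 B0. small_model K C M \<and> small_subset C A \<and> small_subset C B \<and>
        A0 \<subseteq> A \<and> B0 \<subseteq> B \<and> ind A M B \<longrightarrow> ind A0 M B0)"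

definition ind_normality ::
  "('f, 'r, 'a) aclass \<Rightarrow> ('f, 'r, 'a) struc \<Rightarrow> ('f, 'r, 'a) indep \<Rightarrow> bool" where
  "ind_normality K C ind \<longleftrightarrow>
     (\<forall>A M B. small_model K C M \<and> small_subset C A \<and> small_subset C B \<longrightarrow>
        (ind A M B \<longleftrightarrow> ind (A \<union> uni M) M (B \<union> uni M)))"

definition ind_base_monotonicity ::
  "('f, 'r, 'a) aclass \<Rightarrow> ('f, 'r, 'a) struc \<Rightarrow> ('f, 'r, 'a) indep \<Rightarrow> bool" where
  "ind_base_monotonicity K C ind \<longleftrightarrow>
     (\<forall>A M N B. small_model K C M \<and> small_model K C N \<and> small_subset C A \<and> small_subset C B \<and>
        ind A M B \<and> leK K M N \<and> uni N \<subseteq> B \<longrightarrow> ind A N B)"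

definition ind_existence ::
  "'o::wellorder itself \<Rightarrow> ('f, 'r, 'a) aclass \<Rightarrow> ('f, 'r, 'a) struc \<Rightarrow> ('f, 'r, 'a) indep \<Rightarrow> bool"
  where
  "ind_existence ord K C ind \<longleftrightarrow>
     (\<forall>M N. \<forall>p :: ('o \<Rightarrow> 'a option) set.
        small_model K C M \<and> small_model K C N \<and> leK K M N \<and> p \<in> gS_all K C (uni M) \<longrightarrow>
        (\<exists>q\<in>gS_all K C (uni N). grestrict K C q (uni M) = p \<and> nonforking K C ind q (uni N) M))"

definition ind_transitivity ::
  "('f, 'r, 'a) aclass \<Rightarrow> ('f, 'r, 'a) struc \<Rightarrow> ('f, 'r, 'a) indep \<Rightarrow> bool" where
  "ind_transitivity K C ind \<longleftrightarrow>
     (\<forall>A M N B. small_model K C M \<and> small_model K C N \<and> small_subset C A \<and> small_subset C B \<and>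
        leK K M N \<and> ind A M (uni N) \<and> ind A N B \<longrightarrow> ind A M B)"

definition independence_relation ::
  "'o::wellorder itself \<Rightarrow> ('f, 'r, 'a) aclass \<Rightarrow> ('f, 'r, 'a) struc \<Rightarrow> ('f, 'r, 'a) indep \<Rightarrow> bool"
  where
  "independence_relation ord K C ind \<longleftrightarrow>
     ind_invariance K C ind \<and> ind_monotonicity K C ind \<and> ind_normality K C ind \<and>
     ind_base_monotonicity K C ind \<and> ind_existence ord K C ind \<and> ind_transitivity K C ind"

definition ind_symmetry ::
  "('f, 'r, 'a) aclass \<Rightarrow> ('f, 'r, 'a) struc \<Rightarrow> ('f, 'r, 'a) indep \<Rightarrow> bool" where
  "ind_symmetry K C ind \<longleftrightarrow>
     (\<forall>A M B. small_model K C M \<and> small_subset C A \<and> small_subset C B \<longrightarrow>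
        (ind A M B \<longleftrightarrow> ind B M A))"

definition ind_type_amalgamation ::
  "'o::wellorder itself \<Rightarrow> ('f, 'r, 'a) aclass \<Rightarrow> ('f, 'r, 'a) struc \<Rightarrow> ('f, 'r, 'a) indep \<Rightarrow> bool"
  where
  "ind_type_amalgamation ord K C ind \<longleftrightarrow>
     (\<forall>M A B N. \<forall>p q1 q2 :: ('o \<Rightarrow> 'a option) set.
        small_model K C M \<and> small_subset C A \<and> small_subset C B \<and> small_model K C N \<and>
        p \<in> gS_all K C (uni M) \<and> uni M \<subseteq> A \<and> uni M \<subseteq> B \<and> ind A M B \<and> A \<union> B \<subseteq> uni N \<and>
        q1 \<in> gS_all K C A \<and> grestrict K C q1 (uni M) = p \<and> nonforking K C ind q1 A M \<and>
        q2 \<in> gS_all K C B \<and> grestrict K C q2 (uni M) = p \<and> nonforking K C ind q2 B M \<longrightarrow>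
        (\<exists>q\<in>gS_all K C (uni N). grestrict K C q A = q1 \<and> grestrict K C q B = q2 \<and>
           nonforking K C ind q (uni N) M))"

text \<open>The cardinal \<open>\<kappa>\<^bsup><\<theta>\<^esup>\<close>, the supremum of the \<open>\<kappa>\<^bsup>\<mu>\<^esup>\<close> for cardinals \<open>\<mu> < \<theta>\<close>.\<close>

definition cexp_below :: "'b rel \<Rightarrow> 'c rel \<Rightarrow> ('c \<Rightarrow> 'b) rel" where
  "cexp_below \<kappa> \<theta> = (SOME \<sigma>.
     Card_order \<sigma> \<and> (\<forall>\<mu> :: 'c rel. Card_order \<mu> \<and> \<mu> <o \<theta> \<longrightarrow> \<kappa> ^c \<mu> \<le>o \<sigma>) \<and>
     (\<forall>\<tau> :: ('c \<Rightarrow> 'b) rel. Card_order \<tau> \<and>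
        (\<forall>\<mu> :: 'c rel. Card_order \<mu> \<and> \<mu> <o \<theta> \<longrightarrow> \<kappa> ^c \<mu> \<le>o \<tau>) \<longrightarrow> \<sigma> \<le>o \<tau>))"

text \<open>The monster model is larger than the two cardinals; otherwise the condition would be void.\<close>

definition ind_uniform_local_character ::
  "'o::wellorder itself \<Rightarrow> ('f, 'r, 'a) aclass \<Rightarrow> ('f, 'r, 'a) struc \<Rightarrow> ('f, 'r, 'a) indep \<Rightarrow> bool"
  where
  "ind_uniform_local_character ord K C ind \<longleftrightarrow>
     (\<exists>(\<chi> :: 'a rel) (\<theta> :: 'a rel).
        Card_order \<chi> \<and> Card_order \<theta> \<and> \<chi> <o |uni C| \<and> \<theta> <o |uni C| \<and>
        (\<forall>\<alpha> :: 'o. \<forall>M. \<forall>p\<in>gS K C \<alpha> (uni M). small C {..<\<alpha>} \<and> small_model K C M \<longrightarrow>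
           (\<exists>M0. small_model K C M0 \<and> leK K M0 M \<and> nonforking K C ind p (uni M) M0 \<and>
              |uni M0| \<le>o \<chi> +c cexp_below |{..<\<alpha>}| \<theta>)))"

definition simple_independence_relation ::
  "'o::wellorder itself \<Rightarrow> ('f, 'r, 'a) aclass \<Rightarrow> ('f, 'r, 'a) struc \<Rightarrow> ('f, 'r, 'a) indep \<Rightarrow> bool"
  where
  "simple_independence_relation ord K C ind \<longleftrightarrow>
     independence_relation ord K C ind \<and> ind_symmetry K C ind \<and>
     ind_type_amalgamation ord K C ind \<and> ind_uniform_local_character ord K C ind"

definition is_succ :: "'o::wellorder \<Rightarrow> 'o \<Rightarrow> bool" where
  "is_succ \<beta> \<alpha> \<longleftrightarrow> \<beta> < \<alpha> \<and> (\<forall>\<gamma>. \<beta> < \<gamma> \<longrightarrow> \<alpha> \<le> \<gamma>)"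

definition is_zero :: "'o::wellorder \<Rightarrow> bool" where
  "is_zero \<alpha> \<longleftrightarrow> (\<forall>\<beta>. \<alpha> \<le> \<beta>)"

definition is_limit :: "'o::wellorder \<Rightarrow> bool" where
  "is_limit \<alpha> \<longleftrightarrow> \<not> is_zero \<alpha> \<and> (\<nexists>\<beta>. is_succ \<beta> \<alpha>)"

definition continuous_chain ::
  "('f, 'r, 'a) aclass \<Rightarrow> ('f, 'r, 'a) struc \<Rightarrow> 'o::wellorder \<Rightarrow> ('o \<Rightarrow> ('f, 'r, 'a) struc) \<Rightarrow> bool"
  where
  "continuous_chain K C \<delta> M \<longleftrightarrow>
     (\<forall>i\<le>\<delta>. small_model K C (M i)) \<and>
     (\<forall>i j. i \<le> j \<and> j \<le> \<delta> \<longrightarrow> leK K (M i) (M j)) \<and>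
     (\<forall>j\<le>\<delta>. is_limit j \<longrightarrow> uni (M j) = (\<Union>i\<in>{..<j}. uni (M i)))"

definition ind_finite_local_character ::
  "'o::wellorder itself \<Rightarrow> ('f, 'r, 'a) aclass \<Rightarrow> ('f, 'r, 'a) struc \<Rightarrow> ('f, 'r, 'a) indep \<Rightarrow> bool"
  where
  "ind_finite_local_character ord K C ind \<longleftrightarrow>
     (\<forall>\<delta> :: 'o. \<forall>M. \<forall>p :: ('o \<Rightarrow> 'a option) set.
        is_limit \<delta> \<and> continuous_chain K C \<delta> M \<and> p \<in> gS1 K C (uni (M \<delta>)) \<longrightarrow>
        (\<exists>i<\<delta>. nonforking K C ind p (uni (M \<delta>)) (M i)))"

definition supersimple_independence_relation ::
  "'o::wellorder itself \<Rightarrow> ('f, 'r, 'a) aclass \<Rightarrow> ('f, 'r, 'a) struc \<Rightarrow> ('f, 'r, 'a) indep \<Rightarrow> bool"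
  where
  "supersimple_independence_relation ord K C ind \<longleftrightarrow>
     simple_independence_relation ord K C ind \<and> ind_finite_local_character ord K C ind"

definition finite_witness_property_singletons ::
  "('f, 'r, 'a) aclass \<Rightarrow> ('f, 'r, 'a) struc \<Rightarrow> ('f, 'r, 'a) indep \<Rightarrow> bool" where
  "finite_witness_property_singletons K C ind \<longleftrightarrow>
     (\<forall>M N b. small_model K C M \<and> small_model K C N \<and> leK K M N \<and> b \<in> uni C \<longrightarrow>
        (ind {b} M (uni N) \<longleftrightarrow> (\<forall>A. finite A \<and> A \<subseteq> uni N \<longrightarrow> ind {b} M A)))"

section \<open>The rank\<close>

definition forking_extension ::
  "('f, 'r, 'a) aclass \<Rightarrow> ('f, 'r, 'a) struc \<Rightarrow> ('f, 'r, 'a) indep \<Rightarrow>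
     ('f, 'r, 'a) struc \<Rightarrow> ('o::wellorder \<Rightarrow> 'a option) set \<Rightarrow>
     ('f, 'r, 'a) struc \<Rightarrow> ('o \<Rightarrow> 'a option) set \<Rightarrow> bool" where
  "forking_extension K C ind M p N q \<longleftrightarrow>
     leK K M N \<and> p \<in> gS1 K C (uni M) \<and> q \<in> gS1 K C (uni N) \<and>
     grestrict K C q (uni M) = p \<and> \<not> nonforking K C ind q (uni N) M"

text \<open>\<open>U_ge K C ind M p \<alpha>\<close> says that the rank of the type \<open>p\<close> over \<open>M\<close> is at least \<open>\<alpha>\<close>. Every \<open>\<alpha>\<close> is
  of exactly one of the three kinds and the premises only refer to smaller ordinals, so the
  three implications are equivalences and define the predicate by recursion on \<open>\<alpha>\<close>.\<close>

inductive U_ge ::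
  "('f, 'r, 'a) aclass \<Rightarrow> ('f, 'r, 'a) struc \<Rightarrow> ('f, 'r, 'a) indep \<Rightarrow>
     ('f, 'r, 'a) struc \<Rightarrow> ('o::wellorder \<Rightarrow> 'a option) set \<Rightarrow> 'o \<Rightarrow> bool"
  for K C ind where
  zero: "is_zero \<alpha> \<Longrightarrow> U_ge K C ind M p \<alpha>"
| succ: "is_succ \<beta> \<alpha> \<Longrightarrow> small_model K C M' \<Longrightarrow> |uni M'| =o |uni M| \<Longrightarrow>
         forking_extension K C ind M p M' p' \<Longrightarrow> U_ge K C ind M' p' \<beta> \<Longrightarrow> U_ge K C ind M p \<alpha>"
| limit: "is_limit \<alpha> \<Longrightarrow> (\<And>\<beta>. \<beta> < \<alpha> \<Longrightarrow> U_ge K C ind M p \<beta>) \<Longrightarrow> U_ge K C ind M p \<alpha>"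

definition U_infinite ::
  "('f, 'r, 'a) aclass \<Rightarrow> ('f, 'r, 'a) struc \<Rightarrow> ('f, 'r, 'a) indep \<Rightarrow>
     ('f, 'r, 'a) struc \<Rightarrow> ('o::wellorder \<Rightarrow> 'a option) set \<Rightarrow> bool" where
  "U_infinite K C ind M p \<longleftrightarrow> (\<forall>\<alpha>. U_ge K C ind M p \<alpha>)"

end

theory Submission
  imports Defs
begin

text \<open>
  Let \<open>tp(b/M)\<close> have infinite rank. Counting pairs of a model and a type gives an \<open>\<alpha>\<close> such that
  rank at least \<open>\<alpha>\<close> implies rank at least \<open>\<alpha> + 1\<close>, hence infinite rank; so some forking extension
  of \<open>tp(b/M)\<close> to a model of the same size again has infinite rank. An automorphism over \<open>M\<close> makes
  \<open>b\<close> realize it. Iterating gives an \<open>\<omega>\<close>-chain of models along which the type of \<open>b\<close> forks at every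
  step, against finite local character at the union.

  Conversely, let \<open>tp(b/M\<^sub>\<delta>)\<close> fork over every \<open>M\<^sub>i\<close>. By the witness property, for each \<open>i\<close> there is
  \<open>j < \<delta>\<close> such that \<open>b\<close> is dependent on \<open>M\<^sub>j\<close> over \<open>M\<^sub>i\<close>. The rank only allows extensions to models
  of the same size while the \<open>M\<^sub>i\<close> may grow, so consider models \<open>N \<supseteq> M\<^sub>i\<close> of a fixed large size that
  are independent from \<open>b M\<^sub>\<delta>\<close> over \<open>M\<^sub>i\<close>. By symmetry and base monotonicity \<open>b M\<^sub>\<delta>\<close> is independent
  from \<open>N M\<^sub>j\<close> over \<open>M\<^sub>j\<close>, and type-amalgamation extends \<open>N M\<^sub>j\<close> to such a model \<open>N'\<close> for \<open>j\<close>. By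
  transitivity \<open>b\<close> is dependent on \<open>N'\<close> over \<open>N\<close>. So every \<open>tp(b/N)\<close> has a forking extension of the
  same kind, and its rank is infinite.
\<close>

section \<open>Well-ordered types as ordinals\<close>

lemma is_succ_unique: "is_succ \<beta> \<alpha> \<Longrightarrow> is_succ \<gamma> \<alpha> \<Longrightarrow> \<beta> = \<gamma>"
  unfolding is_succ_def by (metis leD linorder_neqE)

lemma is_succ_not_zero: "is_succ \<beta> \<alpha> \<Longrightarrow> \<not> is_zero \<alpha>"
  unfolding is_succ_def is_zero_def by (meson leD)

lemma is_succ_less_iff: "is_succ \<beta> \<alpha> \<Longrightarrow> \<gamma> < \<alpha> \<longleftrightarrow> \<gamma> \<le> \<beta>"
  unfolding is_succ_def by (meson leD leI le_less_trans)

lemma exists_is_succ: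
  fixes \<alpha> \<beta> :: "'o::wellorder"
  assumes "\<alpha> < \<beta>"
  shows "\<exists>\<gamma>. is_succ \<alpha> \<gamma>"
proof
  show "is_succ \<alpha> (LEAST \<gamma>. \<alpha> < \<gamma>)"
    unfolding is_succ_def using LeastI[of "\<lambda>\<gamma>. \<alpha> < \<gamma>", OF assms] Least_le[of "\<lambda>\<gamma>. \<alpha> < \<gamma>"] by auto
qed

lemma is_limit_iff:
  fixes \<alpha> :: "'o::wellorder"
  shows "is_limit \<alpha> \<longleftrightarrow> (\<exists>\<beta>. \<beta> < \<alpha>) \<and> (\<forall>\<beta><\<alpha>. \<exists>\<gamma><\<alpha>. \<beta> < \<gamma>)"
  unfolding is_limit_def is_zero_def is_succ_def by (meson leD not_le)

lemma ordinal_cases [case_names zero succ limit]: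
  fixes \<alpha> :: "'o::wellorder"
  obtains "is_zero \<alpha>" | \<beta> where "is_succ \<beta> \<alpha>" | "is_limit \<alpha>"
  unfolding is_limit_def by blast

lemma ordinal_induct [case_names zero succ limit]:
  fixes \<alpha> :: "'o::wellorder"
  assumes zero: "\<And>\<alpha>. is_zero \<alpha> \<Longrightarrow> P \<alpha>"
    and succ: "\<And>\<beta> \<alpha>. is_succ \<beta> \<alpha> \<Longrightarrow> P \<beta> \<Longrightarrow> P \<alpha>"
    and limit: "\<And>\<alpha>. is_limit \<alpha> \<Longrightarrow> (\<And>\<beta>. \<beta> < \<alpha> \<Longrightarrow> P \<beta>) \<Longrightarrow> P \<alpha>"
  shows "P \<alpha>"
proof (induction \<alpha> rule: less_induct)
  case (less \<alpha>)
  show ?case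
  proof (cases \<alpha> rule: ordinal_cases)
    case (succ \<beta>)
    then show ?thesis using assms(2) less.IH by (simp add: is_succ_def)
  qed (use assms(1,3) less.IH in auto)
qed

lemma lessThan_ord_one:
  assumes "\<exists>x y :: 'o::wellorder. x \<noteq> y"
  shows "{..<ord_one :: 'o} = {LEAST x. True}"
proof -
  let ?bot = "LEAST x :: 'o. True"
  have bot: "?bot \<le> x" for x by (rule Least_le) simp
  obtain y :: 'o where "y \<noteq> ?bot" using assms by metis
  then have "\<exists>\<alpha> \<beta> :: 'o. \<beta> < \<alpha>" using bot by (metis le_imp_less_or_eq)
  then have "\<exists>\<beta> :: 'o. \<beta> < ord_one" unfolding ord_one_def by (rule LeastI_ex)
  then have "?bot < ord_one" using bot le_less_trans by blast
  moreover have "ord_one \<le> x" if "?bot < x" for x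
    unfolding ord_one_def by (rule Least_le) (use that in blast)
  ultimately have "x < ord_one \<longleftrightarrow> x = ?bot" for x using bot[of x] by (metis le_less leD)
  then show ?thesis by (simp add: set_eq_iff)
qed

lemma well_order_on_range:
  fixes f :: "'i::wellorder \<Rightarrow> 'b"
  assumes mono: "\<And>i j. i \<le> j \<Longrightarrow> R (f i) (f j)"
    and trans: "\<And>x y z. R x y \<Longrightarrow> R y z \<Longrightarrow> R x z"
    and antisym: "\<And>x y. R x y \<Longrightarrow> R y x \<Longrightarrow> x = y"
  shows "well_order_on (range f) {(x, y). x \<in> range f \<and> y \<in> range f \<and> R x y}"
proof -
  let ?r = "{(x, y). x \<in> range f \<and> y \<in> range f \<and> R x y}"
  define index where "index x = (LEAST i. f i = x)" for x
  have f_index: "f (index x) = x" if "x \<in> range f" for x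
    unfolding index_def by (rule LeastI_ex) (use that in blast)
  have "linear_order_on (range f) ?r"
    unfolding linear_order_on_def partial_order_on_def preorder_on_def
  proof (intro conjI)
    show "refl_on (range f) ?r" unfolding refl_on_def using mono by auto
    show "trans ?r" unfolding trans_def using trans by blast
    show "antisym ?r" unfolding antisym_def using antisym by blast
    have "R (f i) (f j) \<or> R (f j) (f i)" for i j using mono linear[of i j] by blast
    then show "total_on (range f) ?r" unfolding total_on_def by blast
  qed blast
  moreover have "?r - Id \<subseteq> inv_image {(i, j). i < j} index"
  proof
    fix x assume "x \<in> ?r - Id"
    then obtain y z where yz: "x = (y, z)" "y \<in> range f" "z \<in> range f" "R y z" "y \<noteq> z" by auto
    have "\<not> index z \<le> index y"
      using mono[of "index z" "index y"] f_index yz antisym by auto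
    then show "x \<in> inv_image {(i, j). i < j} index" using yz(1) by simp
  qed
  then have "wf (?r - Id)" using wf_inv_image[OF wf] wf_subset by blast
  ultimately show ?thesis by (simp add: well_order_on_def)
qed

lemma Well_order_iso_lessThan:
  fixes r :: "'b rel"
  assumes r: "Well_order r" and less: "r <o |UNIV :: 'o::wellorder set|"
  obtains \<alpha> :: "'o::wellorder" and f where "bij_betw f (Field r) {..<\<alpha>}"
    "\<And>x y. x \<in> Field r \<Longrightarrow> y \<in> Field r \<Longrightarrow> (x, y) \<in> r \<longleftrightarrow> f x \<le> f y"
proof -
  define W where "W = {(x :: 'o, y). x \<le> y}"
  have Field_W: "Field W = UNIV" by (auto simp: W_def Field_def)
  have W: "Well_order W"
    using well_order_on_range[of "(\<le>)" "id :: 'o \<Rightarrow> 'o"] Field_W by (auto simp: W_def)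
  then have "|UNIV :: 'o set| \<le>o W" using card_of_least[of UNIV W] Field_W by simp
  with less have "r <o W" by (rule ordLess_ordLeq_trans)
  then obtain \<alpha> where initial: "r =o Restr W (underS W \<alpha>)"
    using ordLess_iff_ordIso_Restr[OF W r] by blast
  have underS: "underS W \<alpha> = {..<\<alpha>}" by (auto simp: underS_def W_def)
  have Field: "Field (Restr W {..<\<alpha>}) = {..<\<alpha>}" by (auto simp: Field_def W_def)
  obtain f where "iso r (Restr W {..<\<alpha>}) f" using initial underS by (auto simp: ordIso_def)
  then have f: "bij_betw f (Field r) {..<\<alpha>}"
    "\<And>x y. x \<in> Field r \<Longrightarrow> y \<in> Field r \<Longrightarrow> (x, y) \<in> r \<longleftrightarrow> (f x, f y) \<in> Restr W {..<\<alpha>}"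
    unfolding iso_iff2 Field by auto
  have "(x, y) \<in> r \<longleftrightarrow> f x \<le> f y" if "x \<in> Field r" "y \<in> Field r" for x y
    using that f(1) f(2)[OF that] by (auto simp: W_def bij_betw_def)
  with f(1) show ?thesis by (rule that)
qed

lemma enumerate_by_ordinal:
  assumes "|T| <o |UNIV :: 'o::wellorder set|"
  obtains \<alpha> :: "'o::wellorder" and t where "dom t = {..<\<alpha>}" "ran t = T" "|{..<\<alpha>}| =o |T|"
proof -
  obtain \<alpha> :: 'o and f where f: "bij_betw f T {..<\<alpha>}"
    using Well_order_iso_lessThan[OF card_of_Well_order assms] Field_card_of by metis
  define t where "t i = (if i < \<alpha> then Some (inv_into T f i) else None)" for i
  have "dom t = {..<\<alpha>}" by (auto simp: t_def dom_def)
  moreover have "ran t = inv_into T f ` {..<\<alpha>}"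
    unfolding t_def ran_def by (auto split: if_splits)
  then have "ran t = T" using bij_betw_inv_into[OF f] by (simp add: bij_betw_def)
  moreover have "|{..<\<alpha>}| =o |T|" using f card_of_ordIsoI ordIso_symmetric by blast
  ultimately show ?thesis by (rule that)
qed

lemma exists_omega:
  assumes "|UNIV :: nat set| <o |UNIV :: 'o::wellorder set|"
  obtains \<omega> :: "'o::wellorder" and e :: "nat \<Rightarrow> 'o" where "strict_mono e" "range e = {..<\<omega>}"
proof -
  have "natLeq <o |UNIV :: 'o set|"
    using assms card_of_nat ordIso_ordLess_trans ordIso_symmetric by blast
  from Well_order_iso_lessThan[OF natLeq_Well_order this]
  obtain \<omega> :: 'o and e where e: "bij_betw e UNIV {..<\<omega>}" "\<And>m n. (m, n) \<in> natLeq \<longleftrightarrow> e m \<le> e n"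
    unfolding Field_natLeq by (metis UNIV_I)
  have "strict_mono e"
    unfolding strict_mono_def using e(2) by (simp add: natLeq_def not_le[symmetric])
  moreover have "range e = {..<\<omega>}" using e(1) by (simp add: bij_betw_def)
  ultimately show ?thesis by (rule that)
qed

lemma is_limit_upto_omega_iff:
  fixes \<omega> :: "'o::wellorder" and e :: "nat \<Rightarrow> 'o"
  assumes e: "strict_mono e" "range e = {..<\<omega>}" and "\<alpha> \<le> \<omega>"
  shows "is_limit \<alpha> \<longleftrightarrow> \<alpha> = \<omega>"
proof
  have below: "\<exists>n. \<beta> = e n" if "\<beta> < \<omega>" for \<beta> using that e(2) by (metis lessThan_iff rangeE)
  assume limit: "is_limit \<alpha>"
  show "\<alpha> = \<omega>"
  proof (rule ccontr)
    assume "\<alpha> \<noteq> \<omega>"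
    then have "\<alpha> < \<omega>" using \<open>\<alpha> \<le> \<omega>\<close> by simp
    then obtain n where n: "\<alpha> = e n" using below by blast
    then obtain m where m: "n = Suc m"
      using limit below \<open>\<alpha> < \<omega>\<close> e(1) unfolding is_limit_iff
      by (metis less_trans not0_implies_Suc not_less_zero strict_mono_less)
    then have "e m < \<alpha>" using n e(1) by (simp add: strict_mono_less)
    then obtain \<gamma> where "e m < \<gamma>" "\<gamma> < \<alpha>" using limit unfolding is_limit_iff by blast
    moreover then obtain k where "\<gamma> = e k" using below \<open>\<alpha> < \<omega>\<close> less_trans by blast
    ultimately show False using n m e(1) by (simp add: strict_mono_less)
  qed
next
  have "\<exists>\<gamma><\<omega>. e n < \<gamma>" for n using e by (metis lessI lessThan_iff rangeI strict_mono_less)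
  moreover assume "\<alpha> = \<omega>"
  ultimately show "is_limit \<alpha>"
    unfolding is_limit_iff using e(2) by (metis lessThan_iff rangeE rangeI)
qed

text \<open>The well-order of \<open>'o\<close> may have small cofinality, so a supremum of the stages at which the
  \<open>Q \<cdot> x\<close> fail for the different \<open>x\<close> need not exist. Counting gives a stage at which none fails.\<close>

lemma antimono_stabilizes:
  fixes Q :: "'o::wellorder \<Rightarrow> 'x \<Rightarrow> bool"
  assumes antimono: "\<And>\<alpha> \<beta> x. Q \<beta> x \<Longrightarrow> \<alpha> \<le> \<beta> \<Longrightarrow> Q \<alpha> x"
    and infinite: "infinite (UNIV :: 'o set)"
    and less: "|UNIV :: 'x set| <o |UNIV :: 'o set|"
  obtains \<alpha> \<alpha>' where "is_succ \<alpha> \<alpha>'" "\<And>x. Q \<alpha> x \<Longrightarrow> Q \<alpha>' x"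
proof (rule ccontr)
  assume "\<not> thesis"
  with that have unstable: "\<exists>x. Q \<alpha> x \<and> \<not> Q \<alpha>' x" if "is_succ \<alpha> \<alpha>'" for \<alpha> \<alpha>'
    using \<open>is_succ \<alpha> \<alpha>'\<close> by blast
  define D where "D = {\<alpha> :: 'o. \<exists>\<alpha>'. is_succ \<alpha> \<alpha>'}"
  have "\<exists>x. Q \<alpha> x \<and> (\<forall>\<beta>>\<alpha>. \<not> Q \<beta> x)" if "\<alpha> \<in> D" for \<alpha>
  proof -
    obtain \<alpha>' where succ: "is_succ \<alpha> \<alpha>'" using \<open>\<alpha> \<in> D\<close> by (auto simp: D_def)
    then obtain x where x: "Q \<alpha> x" "\<not> Q \<alpha>' x" using unstable by blast
    have "\<not> Q \<beta> x" if "\<alpha> < \<beta>" for \<beta> using that succ x(2) antimono by (auto simp: is_succ_def)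
    with x(1) show ?thesis by blast
  qed
  then have "\<forall>\<alpha>\<in>D. \<exists>x. Q \<alpha> x \<and> (\<forall>\<beta>>\<alpha>. \<not> Q \<beta> x)" by blast
  from bchoice[OF this] obtain g where g: "\<forall>\<alpha>\<in>D. Q \<alpha> (g \<alpha>) \<and> (\<forall>\<beta>>\<alpha>. \<not> Q \<beta> (g \<alpha>))" by blast
  have "g \<alpha> \<noteq> g \<beta>" if "\<alpha> \<in> D" "\<beta> \<in> D" "\<alpha> < \<beta>" for \<alpha> \<beta> using g that by metis
  then have "inj_on g D" by (intro inj_onI) (metis linorder_neqE)
  then have "|D| \<le>o |UNIV :: 'x set|" using card_of_ordLeq by (metis subset_UNIV)
  then have D_less: "|D| <o |UNIV :: 'o set|" using less by (rule ordLeq_ordLess_trans)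
  have "\<alpha> = \<beta>" if "\<alpha> \<notin> D" "\<beta> \<notin> D" for \<alpha> \<beta>
    using that exists_is_succ unfolding D_def by (metis linorder_neqE mem_Collect_eq)
  then have "\<exists>\<alpha>. - D \<subseteq> {\<alpha>}" by blast
  then have "finite (- D)" using finite_subset by blast
  then have "|- D| <o |UNIV :: 'o set|"
    using infinite finite_ordLess_infinite[of "|- D|" "|UNIV :: 'o set|"]
    by (simp add: Field_card_of card_of_well_order_on)
  from card_of_Un_ordLess_infinite[OF infinite D_less this] show False
    using ordLess_irreflexive[of "|UNIV :: 'o set|"] by (simp add: Compl_partition)
qed

section \<open>Isomorphisms and induced substructures\<close>

lemma struc_eqI:
  fixes M N :: "('f, 'r, 'a) struc"
  shows "uni M = uni N \<Longrightarrow> fint M = fint N \<Longrightarrow> rint M = rint N \<Longrightarrow> M = N"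
  by (cases M, cases N) simp

lemma is_struc_fint:
  "is_struc L M \<Longrightarrow> f \<in> funs L \<Longrightarrow> set xs \<subseteq> uni M \<Longrightarrow> length xs = farity L f \<Longrightarrow> fint M f xs \<in> uni M"
  unfolding is_struc_def by metis

lemma struc_iso_bij: "struc_iso L h M N \<Longrightarrow> bij_betw h (uni M) (uni N)"
  by (simp add: struc_iso_def)

lemma struc_iso_is_struc: "struc_iso L h M N \<Longrightarrow> is_struc L M \<and> is_struc L N"
  by (simp add: struc_iso_def)

lemma struc_iso_fint:
  "struc_iso L h M N \<Longrightarrow> f \<in> funs L \<Longrightarrow> set xs \<subseteq> uni M \<Longrightarrow> length xs = farity L f \<Longrightarrow>
    h (fint M f xs) = fint N f (map h xs)"
  unfolding struc_iso_def by blast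

lemma struc_iso_rint:
  "struc_iso L h M N \<Longrightarrow> r \<in> rels L \<Longrightarrow> set xs \<subseteq> uni M \<Longrightarrow> length xs = rarity L r \<Longrightarrow>
    rint M r xs \<longleftrightarrow> rint N r (map h xs)"
  unfolding struc_iso_def by blast

lemma struc_isoI:
  assumes "is_struc L M" "is_struc L N" "bij_betw h (uni M) (uni N)"
    and "\<And>f xs. f \<in> funs L \<Longrightarrow> set xs \<subseteq> uni M \<Longrightarrow> length xs = farity L f \<Longrightarrow>
      h (fint M f xs) = fint N f (map h xs)"
    and "\<And>r xs. r \<in> rels L \<Longrightarrow> set xs \<subseteq> uni M \<Longrightarrow> length xs = rarity L r \<Longrightarrow>
      rint M r xs \<longleftrightarrow> rint N r (map h xs)"
  shows "struc_iso L h M N"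
  using assms by (simp add: struc_iso_def)

lemma struc_iso_inv_into:
  assumes iso: "struc_iso L h M N"
  shows "struc_iso L (inv_into (uni M) h) N M"
proof (rule struc_isoI)
  let ?g = "inv_into (uni M) h"
  note bij = struc_iso_bij[OF iso]
  show bij_inv: "bij_betw ?g (uni N) (uni M)" by (rule bij_betw_inv_into[OF bij])
  show "is_struc L N" "is_struc L M" using struc_iso_is_struc[OF iso] by auto
  have map_in: "set (map ?g xs) \<subseteq> uni M" if "set xs \<subseteq> uni N" for xs
    using that bij_inv by (auto simp: bij_betw_def)
  have map_h_map_g: "map h (map ?g xs) = xs" if "set xs \<subseteq> uni N" for xs
    unfolding map_map by (rule map_idI) (use that bij_betw_inv_into_right[OF bij] in auto)
  show "rint N r xs \<longleftrightarrow> rint M r (map ?g xs)"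
    if "r \<in> rels L" "set xs \<subseteq> uni N" "length xs = rarity L r" for r xs
    using struc_iso_rint[OF iso that(1) map_in[OF that(2)]] that map_h_map_g by simp
  show "?g (fint N f xs) = fint M f (map ?g xs)"
    if xs: "f \<in> funs L" "set xs \<subseteq> uni N" "length xs = farity L f" for f xs
  proof -
    have "h (fint M f (map ?g xs)) = fint N f xs"
      using struc_iso_fint[OF iso xs(1) map_in[OF xs(2)]] xs map_h_map_g by simp
    moreover have "fint M f (map ?g xs) \<in> uni M"
      using is_struc_fint[OF \<open>is_struc L M\<close> xs(1) map_in[OF xs(2)]] xs(3) by simp
    ultimately show ?thesis using bij_betw_inv_into_left[OF bij] by metis
  qed
qed

lemma struc_iso_comp:
  assumes h: "struc_iso L h M N" and g: "struc_iso L g N P"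
  shows "struc_iso L (g \<circ> h) M P"
proof (rule struc_isoI)
  have map_in: "set (map h xs) \<subseteq> uni N" if "set xs \<subseteq> uni M" for xs
    using that struc_iso_bij[OF h] by (auto simp: bij_betw_def)
  show "(g \<circ> h) (fint M f xs) = fint P f (map (g \<circ> h) xs)"
    if "f \<in> funs L" "set xs \<subseteq> uni M" "length xs = farity L f" for f xs
    using struc_iso_fint[OF h that] struc_iso_fint[OF g that(1) map_in[OF that(2)]] that(3) by simp
  show "rint M r xs \<longleftrightarrow> rint P r (map (g \<circ> h) xs)"
    if "r \<in> rels L" "set xs \<subseteq> uni M" "length xs = rarity L r" for r xs
    using struc_iso_rint[OF h that] struc_iso_rint[OF g that(1) map_in[OF that(2)]] that(3) by simp
  show "is_struc L M" "is_struc L P"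
    using struc_iso_is_struc[OF h] struc_iso_is_struc[OF g] by auto
  show "bij_betw (g \<circ> h) (uni M) (uni P)"
    by (rule bij_betw_trans[OF struc_iso_bij[OF h] struc_iso_bij[OF g]])
qed

lemma struc_iso_id:
  assumes "is_struc L M"
  shows "struc_iso L id M M"
  by (rule struc_isoI) (use assms in auto)

lemma substruc_is_struc: "substruc L M N \<Longrightarrow> is_struc L M \<and> is_struc L N"
  by (simp add: substruc_def)

lemma substruc_uni: "substruc L M N \<Longrightarrow> uni M \<subseteq> uni N"
  by (simp add: substruc_def)

lemma substruc_fint:
  "substruc L M N \<Longrightarrow> f \<in> funs L \<Longrightarrow> set xs \<subseteq> uni M \<Longrightarrow> length xs = farity L f \<Longrightarrow>
    fint M f xs = fint N f xs"
  unfolding substruc_def by blast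

lemma substruc_rint:
  "substruc L M N \<Longrightarrow> r \<in> rels L \<Longrightarrow> set xs \<subseteq> uni M \<Longrightarrow> length xs = rarity L r \<Longrightarrow>
    rint M r xs \<longleftrightarrow> rint N r xs"
  unfolding substruc_def by blast

definition restr_struc ::
  "('f, 'r) language \<Rightarrow> ('f, 'r, 'a) struc \<Rightarrow> 'a set \<Rightarrow> ('f, 'r, 'a) struc" where
  "restr_struc L N X =
     \<lparr>uni = X,
      fint = (\<lambda>f xs. if f \<in> funs L \<and> set xs \<subseteq> X \<and> length xs = farity L f
                     then fint N f xs else undefined),
      rint = (\<lambda>r xs. r \<in> rels L \<and> set xs \<subseteq> X \<and> length xs = rarity L r \<and> rint N r xs)\<rparr>"

lemma uni_restr_struc [simp]: "uni (restr_struc L N X) = X"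
  by (simp add: restr_struc_def)

lemma is_struc_restr_struc:
  assumes "X \<noteq> {}"
    and "\<And>f xs. f \<in> funs L \<Longrightarrow> set xs \<subseteq> X \<Longrightarrow> length xs = farity L f \<Longrightarrow> fint N f xs \<in> X"
  shows "is_struc L (restr_struc L N X)"
  using assms unfolding is_struc_def restr_struc_def by simp

lemma restr_struc_substruc:
  assumes sub: "substruc L M N"
  shows "restr_struc L N (uni M) = M"
proof (rule struc_eqI)
  note M = substruc_is_struc[OF sub, THEN conjunct1]
  show "fint (restr_struc L N (uni M)) = fint M"
  proof (intro ext)
    fix f xs
    have "fint M f xs = undefined"
      if "\<not> (f \<in> funs L \<and> set xs \<subseteq> uni M \<and> length xs = farity L f)"
      using M that unfolding is_struc_def by metis
    then show "fint (restr_struc L N (uni M)) f xs = fint M f xs"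
      using substruc_fint[OF sub] by (auto simp: restr_struc_def)
  qed
  show "rint (restr_struc L N (uni M)) = rint M"
  proof (intro ext)
    fix r xs
    have "rint M r xs \<longrightarrow> r \<in> rels L \<and> set xs \<subseteq> uni M \<and> length xs = rarity L r"
      using M unfolding is_struc_def by blast
    then show "rint (restr_struc L N (uni M)) r xs = rint M r xs"
      using substruc_rint[OF sub] by (auto simp: restr_struc_def)
  qed
qed simp

lemma struc_iso_restr_struc:
  assumes sub: "substruc L M N" and iso: "struc_iso L h N N'"
  shows "struc_iso L h M (restr_struc L N' (h ` uni M))"
proof (rule struc_isoI)
  let ?X = "h ` uni M"
  note MN = substruc_uni[OF sub]
  show M: "is_struc L M" using substruc_is_struc[OF sub] by blast
  have fint: "h (fint M f xs) = fint N' f (map h xs)"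
    if "f \<in> funs L" "set xs \<subseteq> uni M" "length xs = farity L f" for f xs
    using substruc_fint[OF sub that]
      struc_iso_fint[OF iso that(1) order_trans[OF that(2) MN] that(3)] by simp
  have rint: "rint M r xs \<longleftrightarrow> rint N' r (map h xs)"
    if "r \<in> rels L" "set xs \<subseteq> uni M" "length xs = rarity L r" for r xs
    using substruc_rint[OF sub that]
      struc_iso_rint[OF iso that(1) order_trans[OF that(2) MN] that(3)] by simp
  show "is_struc L (restr_struc L N' ?X)"
  proof (rule is_struc_restr_struc)
    show "?X \<noteq> {}" using M by (simp add: is_struc_def)
  next
    fix f ys assume ys: "f \<in> funs L" "set ys \<subseteq> ?X" "length ys = farity L f"
    then have "ys \<in> lists ?X" by auto
    then obtain xs where "set xs \<subseteq> uni M" "ys = map h xs" unfolding lists_image by auto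
    then show "fint N' f ys \<in> ?X"
      using ys(1,3) fint[of f xs] is_struc_fint[OF M ys(1)] by (metis imageI length_map)
  qed
  have image: "set (map h xs) \<subseteq> ?X" if "set xs \<subseteq> uni M" for xs using that by auto
  show "bij_betw h (uni M) (uni (restr_struc L N' ?X))"
    using struc_iso_bij[OF iso] MN by (auto simp: bij_betw_def intro: inj_on_subset)
  show "h (fint M f xs) = fint (restr_struc L N' ?X) f (map h xs)"
    if "f \<in> funs L" "set xs \<subseteq> uni M" "length xs = farity L f" for f xs
    using fint[OF that] image[OF that(2)] that by (simp add: restr_struc_def)
  show "rint M r xs \<longleftrightarrow> rint (restr_struc L N' ?X) r (map h xs)"
    if "r \<in> rels L" "set xs \<subseteq> uni M" "length xs = rarity L r" for r xs
    using rint[OF that] image[OF that(2)] that by (simp add: restr_struc_def)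
qed

section \<open>Models and automorphisms of the monster model\<close>

lemma
  assumes "is_aec K"
  shows aec_is_struc [rule_format]: "\<forall>M\<in>mods K. is_struc (lang K) M"
    and aec_partial_order: "partial_order_on (mods K) {(M, N). leK K M N}"
    and aec_substruc [rule_format]: "\<forall>M N. leK K M N \<longrightarrow> substruc (lang K) M N"
    and aec_iso [rule_format]: "\<forall>M N M' N' h.
      leK K M N \<and> struc_iso (lang K) h N N' \<and> struc_iso (lang K) h M M' \<longrightarrow> leK K M' N'"
    and aec_coherence [rule_format]:
      "\<forall>M N P. leK K M P \<and> leK K N P \<and> uni M \<subseteq> uni N \<longrightarrow> leK K M N"
    and aec_chain [rule_format]: "\<forall>\<C>. \<C> \<subseteq> mods K \<and> \<C> \<noteq> {} \<and>
      well_order_on \<C> {(M, N). M \<in> \<C> \<and> N \<in> \<C> \<and> leK K M N} \<longrightarrow>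
      (\<exists>U\<in>mods K. uni U = (\<Union>M\<in>\<C>. uni M) \<and> (\<forall>M\<in>\<C>. leK K M U) \<and>
        (\<forall>N\<in>mods K. (\<forall>M\<in>\<C>. leK K M N) \<longrightarrow> leK K U N))"
    and aec_LS_bound: "\<exists>\<mu>. LS_bound K \<mu>"
  by (insert assms[unfolded is_aec_def]) (elim conjE, assumption)+

locale aec_monster =
  fixes K :: "('f, 'r, 'a) aclass" and C :: "('f, 'r, 'a) struc"
  assumes aec: "is_aec K" and monster: "monster_model K C"
begin

abbreviation aut :: "('a \<Rightarrow> 'a) \<Rightarrow> bool" where "aut \<equiv> automorphism K C"

lemma monster_in_mods: "C \<in> mods K"
  using monster by (simp add: monster_model_def)

lemma leK_uni: "leK K M N \<Longrightarrow> uni M \<subseteq> uni N"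
  by (rule substruc_uni[OF aec_substruc[OF aec]])

lemma leK_antisym: "leK K M N \<Longrightarrow> leK K N M \<Longrightarrow> M = N"
  using aec_partial_order[OF aec] by (auto simp: partial_order_on_def antisym_def)

lemma leK_trans: "leK K M N \<Longrightarrow> leK K N P \<Longrightarrow> leK K M P"
  using aec_partial_order[OF aec] unfolding partial_order_on_def preorder_on_def trans_def by blast

lemma leK_mods: "leK K M N \<Longrightarrow> M \<in> mods K"
  using aec_partial_order[OF aec] unfolding partial_order_on_def preorder_on_def refl_on_def
  by blast

lemma small_model_leK: "small_model K C M \<Longrightarrow> leK K M C"
  by (simp add: small_model_def)

lemma small_model_uni: "small_model K C M \<Longrightarrow> uni M \<subseteq> uni C"
  by (rule leK_uni[OF small_model_leK])

lemma small_model_small_subset: "small_model K C M \<Longrightarrow> small_subset C (uni M)"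
  using small_model_uni by (simp add: small_model_def small_subset_def)

lemma leK_iff:
  assumes "small_model K C M" "small_model K C N"
  shows "leK K M N \<longleftrightarrow> uni M \<subseteq> uni N"
  using assms aec_coherence[OF aec] leK_uni unfolding small_model_def by blast

lemma small_model_eqI:
  assumes "small_model K C M" "small_model K C N" "uni M = uni N"
  shows "M = N"
  using assms leK_iff[of M N] leK_iff[of N M] by (simp add: leK_antisym)

lemma aut_bij: "aut h \<Longrightarrow> bij_betw h (uni C) (uni C)"
  unfolding automorphism_def by (rule struc_iso_bij)

lemma aut_in: "aut h \<Longrightarrow> a \<in> uni C \<Longrightarrow> h a \<in> uni C"
  using aut_bij by (auto simp: bij_betw_def)

lemma aut_id: "aut id"
  unfolding automorphism_def by (rule struc_iso_id[OF aec_is_struc[OF aec monster_in_mods]])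

lemma aut_comp: "aut h \<Longrightarrow> aut g \<Longrightarrow> aut (g \<circ> h)"
  unfolding automorphism_def by (rule struc_iso_comp)

definition aut_inv :: "('a \<Rightarrow> 'a) \<Rightarrow> 'a \<Rightarrow> 'a" where
  "aut_inv h = inv_into (uni C) h"

lemma aut_aut_inv: "aut h \<Longrightarrow> aut (aut_inv h)"
  unfolding automorphism_def aut_inv_def by (rule struc_iso_inv_into)

lemma aut_inv_left: "aut h \<Longrightarrow> a \<in> uni C \<Longrightarrow> aut_inv h (h a) = a"
  using aut_bij unfolding aut_inv_def by (metis bij_betw_inv_into_left)

lemma aut_inv_image: "aut h \<Longrightarrow> A \<subseteq> uni C \<Longrightarrow> aut_inv h ` h ` A = A"
  by (force simp: aut_inv_left image_iff subset_iff)

lemma aut_inv_fixes: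
  assumes "aut h" "A \<subseteq> uni C" "\<forall>a\<in>A. h a = a"
  shows "\<forall>a\<in>A. aut_inv h a = a"
  using assms aut_inv_left by (metis subset_iff)

lemma card_of_aut_image:
  assumes "aut h" "A \<subseteq> uni C"
  shows "|h ` A| =o |A|"
proof -
  have "bij_betw h A (h ` A)"
    using assms aut_bij by (meson bij_betw_def inj_on_imp_bij_betw inj_on_subset)
  then show ?thesis using card_of_ordIsoI ordIso_symmetric by blast
qed

lemma small_subset_aut_image:
  assumes "aut h" "small_subset C A"
  shows "small_subset C (h ` A)"
  using assms card_of_aut_image[of h A] aut_in[OF assms(1)]
  unfolding small_subset_def small_def by (auto intro: ordIso_ordLess_trans)

definition aut_model :: "('a \<Rightarrow> 'a) \<Rightarrow> ('f, 'r, 'a) struc \<Rightarrow> ('f, 'r, 'a) struc" where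
  "aut_model h M = restr_struc (lang K) C (h ` uni M)"

lemma uni_aut_model [simp]: "uni (aut_model h M) = h ` uni M"
  by (simp add: aut_model_def)

lemma struc_iso_aut_model:
  assumes "aut h" "small_model K C M"
  shows "struc_iso (lang K) h M (aut_model h M)"
  using struc_iso_restr_struc[OF aec_substruc[OF aec small_model_leK[OF assms(2)]]] assms(1)
  by (simp add: aut_model_def automorphism_def)

lemma small_model_aut_model:
  assumes "aut h" "small_model K C M"
  shows "small_model K C (aut_model h M)"
proof -
  have "leK K (aut_model h M) C"
    using aec_iso[OF aec, of M C h C] small_model_leK[OF assms(2)] struc_iso_aut_model[OF assms]
      assms(1)
    by (simp add: automorphism_def)
  then show ?thesis
    using small_subset_aut_image[OF assms(1) small_model_small_subset[OF assms(2)]]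
    by (simp add: small_model_def small_subset_def)
qed

lemma aut_model_eq:
  assumes "small_model K C N" "uni N = h ` uni M"
  shows "aut_model h M = N"
  using restr_struc_substruc[OF aec_substruc[OF aec small_model_leK[OF assms(1)]]] assms(2)
  by (simp add: aut_model_def)

lemma aut_model_fixed:
  assumes "small_model K C M" "\<forall>a\<in>uni M. h a = a"
  shows "aut_model h M = M"
  by (rule aut_model_eq) (use assms in auto)

lemma card_of_aut_model:
  assumes "aut h" "small_model K C M"
  shows "|uni (aut_model h M)| =o |uni M|"
  using card_of_aut_image[OF assms(1) small_model_uni[OF assms(2)]] by simp

lemma LS_bound_LS: "LS_bound K (LS K)"
proof -
  let ?R = "{\<mu>. LS_bound K \<mu>}"
  have "?R \<noteq> {}" using aec_LS_bound[OF aec] by simp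
  moreover have "\<forall>\<mu>\<in>?R. Well_order \<mu>"
    using card_order_on_well_order_on by (auto simp: LS_bound_def)
  ultimately have "\<exists>\<mu>\<in>?R. \<forall>\<nu>\<in>?R. \<mu> \<le>o \<nu>" by (rule exists_minim_Well_order)
  then have "\<exists>\<mu>. LS_bound K \<mu> \<and> (\<forall>\<nu>. LS_bound K \<nu> \<longrightarrow> \<mu> \<le>o \<nu>)" by auto
  then show ?thesis unfolding LS_def by (rule someI2_ex) auto
qed

lemma LS_less: "LS K <o |uni C|"
  using monster by (simp add: monster_model_def)

lemma infinite_if_LS_le:
  assumes "LS K \<le>o |A|"
  shows "infinite A"
  unfolding infinite_iff_card_of_nat
  using LS_bound_LS assms ordLeq_transitive by (auto simp: LS_bound_def)

lemma infinite_monster: "infinite (uni C)"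
  by (rule infinite_if_LS_le[OF ordLess_imp_ordLeq[OF LS_less]])

lemma small_subset_Un: "small_subset C A \<Longrightarrow> small_subset C B \<Longrightarrow> small_subset C (A \<union> B)"
  using infinite_monster card_of_Un_ordLess_infinite unfolding small_subset_def small_def by blast

lemma small_subset_singleton: "a \<in> uni C \<Longrightarrow> small_subset C {a}"
  using infinite_monster finite_ordLess_infinite[of "|{a}|" "|uni C|"]
  by (simp add: small_subset_def small_def Field_card_of card_of_well_order_on)

lemma exists_small_superset_LS_le:
  assumes "small_subset C A"
  obtains S where "A \<subseteq> S" "small_subset C S" "LS K \<le>o |S|"
proof -
  have LS: "|Field (LS K)| =o LS K"
    using LS_bound_LS by (simp add: LS_bound_def card_of_Field_ordIso)
  then have "|Field (LS K)| \<le>o |uni C|"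
    using LS_less by (meson ordIso_ordLess_trans ordLess_imp_ordLeq)
  then obtain B where B: "B \<subseteq> uni C" "|Field (LS K)| =o |B|"
    using internalize_card_of_ordLeq2 by metis
  then have LS_B: "LS K =o |B|" using LS by (meson ordIso_symmetric ordIso_transitive)
  then have "small_subset C B"
    using B(1) LS_less
    by (auto simp: small_subset_def small_def intro: ordIso_ordLess_trans ordIso_symmetric)
  then have "small_subset C (A \<union> B)" using assms by (intro small_subset_Un)
  moreover have "LS K \<le>o |A \<union> B|"
    by (rule ordIso_ordLeq_trans[OF LS_B]) (simp add: card_of_mono1)
  ultimately show ?thesis using that by blast
qed

lemma small_subset_UN_nat:
  fixes A :: "nat \<Rightarrow> 'a set"
  assumes "\<And>n. A n \<subseteq> uni C" "\<And>n. |A n| \<le>o |B|" "small_subset C B"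
  shows "small_subset C (\<Union>n. A n)"
proof -
  obtain S where S: "B \<subseteq> S" "small_subset C S" "LS K \<le>o |S|"
    using exists_small_superset_LS_le[OF assms(3)] .
  have "infinite S" by (rule infinite_if_LS_le[OF S(3)])
  moreover have "|A n| \<le>o |S|" for n
    by (rule ordLeq_transitive[OF assms(2) card_of_mono1[OF S(1)]])
  ultimately have "|\<Union>n. A n| \<le>o |S|"
    by (intro card_of_UNION_ordLeq_infinite) (auto simp: infinite_iff_card_of_nat)
  then show ?thesis
    using S(2) assms(1) ordLeq_ordLess_trans by (auto simp: small_subset_def small_def)
qed

lemma exists_model_of_card:
  assumes A: "small_subset C A" "|A| \<le>o |S|" and S: "small_subset C S" "LS K \<le>o |S|"
  obtains N where "small_model K C N" "A \<subseteq> uni N" "|uni N| =o |S|"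
proof -
  have inf: "infinite S" by (rule infinite_if_LS_le[OF S(2)])
  have "A \<union> S \<subseteq> uni C" using A S by (auto simp: small_subset_def)
  then obtain N where N: "leK K N C" "A \<union> S \<subseteq> uni N" "|uni N| \<le>o |A \<union> S| +c LS K"
    using LS_bound_LS monster_in_mods unfolding LS_bound_def by blast
  have AS: "|A \<union> S| \<le>o |S|"
    using inf A(2) by (intro card_of_Un_ordLeq_infinite_Field)
      (auto simp: Field_card_of card_of_card_order_on card_of_mono1)
  have "|A \<union> S| +c LS K \<le>o |S| +c |S|" by (rule csum_mono[OF AS S(2)])
  moreover have "|S| +c |S| =o |S|"
    using inf by (intro csum_absorb1)
      (auto simp: cinfinite_def Field_card_of card_of_card_order_on card_of_mono1)
  ultimately have le: "|uni N| \<le>o |S|"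
    using N(3) by (meson ordLeq_ordIso_trans ordLeq_transitive)
  moreover have "|S| \<le>o |uni N|" using N(2) by (simp add: card_of_mono1)
  ultimately have "|uni N| =o |S|" by (simp add: ordIso_iff_ordLeq)
  moreover have "small_model K C N"
    using N(1) le S(1) ordLeq_ordLess_trans
    unfolding small_model_def small_def small_subset_def by blast
  ultimately show ?thesis using that N(2) by blast
qed

lemma exists_union_of_chain:
  fixes N :: "'i::wellorder \<Rightarrow> ('f, 'r, 'a) struc"
  assumes N: "\<And>i. small_model K C (N i)" and mono: "mono (\<lambda>i. uni (N i))"
    and small: "small_subset C (\<Union>i. uni (N i))"
  obtains U where "small_model K C U" "uni U = (\<Union>i. uni (N i))"
proof -
  have "leK K (N i) (N j)" if "i \<le> j" for i j
    using leK_iff[OF N N] monoD[OF mono that] by simp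
  then have "well_order_on (range N) {(M, M'). M \<in> range N \<and> M' \<in> range N \<and> leK K M M'}"
    by (rule well_order_on_range[OF _ leK_trans leK_antisym])
  moreover have "range N \<subseteq> mods K" using leK_mods small_model_leK[OF N] by blast
  ultimately have "range N \<subseteq> mods K \<and> range N \<noteq> {} \<and>
      well_order_on (range N) {(M, M'). M \<in> range N \<and> M' \<in> range N \<and> leK K M M'}"
    by simp
  from aec_chain[OF aec this] obtain U where U: "uni U = (\<Union>M\<in>range N. uni M)"
      "\<forall>M\<in>mods K. (\<forall>M'\<in>range N. leK K M' M) \<longrightarrow> leK K U M"
    by (elim bexE conjE)
  have "leK K U C" using U(2) monster_in_mods small_model_leK[OF N] by blast
  with small show ?thesis using that U(1) by (simp add: small_model_def small_subset_def)
qed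

end

section \<open>Galois types\<close>

lemma ran_map_option_comp: "ran (map_option h \<circ> b) = h ` ran b"
  using ran_map_option[of h b] by (simp add: comp_def)

lemma map_option_comp_comp: "map_option g \<circ> (map_option h \<circ> b) = map_option (g \<circ> h) \<circ> b"
  by (auto simp: fun_eq_iff option.map_comp)

lemma map_option_id_on_ran: "(\<And>a. a \<in> ran b \<Longrightarrow> h a = a) \<Longrightarrow> map_option h \<circ> b = b"
  by (rule ext) (auto intro!: map_option_idI simp: ran_def elem_set)

definition point :: "'a \<Rightarrow> 'o::wellorder \<Rightarrow> 'a option" where
  "point a = [(LEAST x. True) \<mapsto> a]"

lemma ran_point [simp]: "ran (point a) = {a}"
  by (simp add: point_def)

lemma map_option_point: "map_option h \<circ> point a = point (h a)"
  by (auto simp: point_def fun_eq_iff)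

lemma point_inject [simp]: "point a = point b \<longleftrightarrow> a = b"
  by (metis ran_point singleton_inject)

lemma dom_ord_one_iff_point:
  fixes b :: "'o::wellorder \<Rightarrow> 'a option"
  assumes "\<exists>x y :: 'o. x \<noteq> y"
  shows "dom b = {..<ord_one} \<longleftrightarrow> (\<exists>a. b = point a)"
  unfolding lessThan_ord_one[OF assms] point_def dom_eq_singleton_conv ..

context aec_monster
begin

lemma self_in_gtp: "b \<in> gtp K C b A"
  unfolding gtp_def using aut_id by (force simp: option.map_id0)

lemma gtp_aut_subset:
  assumes "aut h" "\<forall>a\<in>A. h a = a"
  shows "gtp K C (map_option h \<circ> b) A \<subseteq> gtp K C b A"
proof
  fix c assume "c \<in> gtp K C (map_option h \<circ> b) A"
  then obtain g where g: "aut g" "\<forall>a\<in>A. g a = a" "c = map_option (g \<circ> h) \<circ> b"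
    by (auto simp: gtp_def map_option_comp_comp)
  moreover have "aut (g \<circ> h)" by (rule aut_comp[OF assms(1) g(1)])
  ultimately show "c \<in> gtp K C b A" unfolding gtp_def using assms(2) by fastforce
qed

lemma gtp_aut_eq:
  assumes h: "aut h" "\<forall>a\<in>A. h a = a" and "A \<subseteq> uni C" "ran b \<subseteq> uni C"
  shows "gtp K C (map_option h \<circ> b) A = gtp K C b A"
proof
  have "map_option (aut_inv h) \<circ> (map_option h \<circ> b) = b"
    unfolding map_option_comp_comp
    by (rule map_option_id_on_ran) (use assms aut_inv_left in auto)
  then show "gtp K C b A \<subseteq> gtp K C (map_option h \<circ> b) A"
    using gtp_aut_subset[OF aut_aut_inv[OF h(1)] aut_inv_fixes[OF h(1) assms(3) h(2)]] by metis
qed (rule gtp_aut_subset[OF h])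

lemma gtp_eq_iff:
  assumes "A \<subseteq> uni C" "ran b \<subseteq> uni C"
  shows "gtp K C b A = gtp K C c A \<longleftrightarrow> (\<exists>h. aut h \<and> (\<forall>a\<in>A. h a = a) \<and> c = map_option h \<circ> b)"
proof
  assume "gtp K C b A = gtp K C c A"
  then have "c \<in> gtp K C b A" using self_in_gtp by blast
  then show "\<exists>h. aut h \<and> (\<forall>a\<in>A. h a = a) \<and> c = map_option h \<circ> b" by (auto simp: gtp_def)
qed (use gtp_aut_eq assms in auto)

lemma grestrict_gtp:
  assumes "A \<subseteq> B" "B \<subseteq> uni C" "ran b \<subseteq> uni C"
  shows "grestrict K C (gtp K C b B) A = gtp K C b A"
proof -
  have "gtp K C c A = gtp K C b A" if c: "c \<in> gtp K C b B" for c
  proof -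
    obtain h where "aut h" "\<forall>a\<in>B. h a = a" "c = map_option h \<circ> b"
      using c by (auto simp: gtp_def)
    then show ?thesis using gtp_aut_eq[of h A b] assms by blast
  qed
  then show ?thesis unfolding grestrict_def using self_in_gtp by blast
qed

lemma gS_all_ran:
  assumes "gtp K C b A \<in> gS_all K C A"
  shows "ran b \<subseteq> uni C"
proof -
  obtain c where c: "gtp K C b A = gtp K C c A" "ran c \<subseteq> uni C"
    using assms by (auto simp: gS_all_def gS_def)
  then have "b \<in> gtp K C c A" using self_in_gtp by metis
  then obtain h where "aut h" "b = map_option h \<circ> c" by (auto simp: gtp_def)
  then show ?thesis using c(2) aut_in by (auto simp: ran_map_option_comp)
qed

end

section \<open>Independence\<close>

locale aec_independence = aec_monster K C
  for K :: "('f, 'r, 'a) aclass" and C :: "('f, 'r, 'a) struc" +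
  fixes ord :: "'o::wellorder itself" and ind :: "('f, 'r, 'a) indep"
  assumes independence: "independence_relation ord K C ind"
    and many_ordinals: "|UNIV :: 'a set set| <o |UNIV :: 'o set|"
begin

lemma ind_aut:
  assumes "aut h" "small_model K C M" "small_subset C A" "small_subset C B" "ind A M B"
  shows "ind (h ` A) (aut_model h M) (h ` B)"
proof -
  have "ind_invariance K C ind" using independence by (simp add: independence_relation_def)
  then show ?thesis
    using assms struc_iso_aut_model[OF assms(1,2)] unfolding ind_invariance_def by blast
qed

lemma ind_mono:
  assumes "ind A M B" "small_model K C M" "small_subset C A" "small_subset C B"
    "A' \<subseteq> A" "B' \<subseteq> B"
  shows "ind A' M B'"
proof -
  have "ind_monotonicity K C ind" using independence by (simp add: independence_relation_def)
  then show ?thesis using assms unfolding ind_monotonicity_def by blast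
qed

lemma ind_Un_base:
  assumes "ind A M B" "small_model K C M" "small_subset C A" "small_subset C B"
  shows "ind A M (B \<union> uni M)"
proof -
  have "ind_normality K C ind" using independence by (simp add: independence_relation_def)
  then have "ind (A \<union> uni M) M (B \<union> uni M)" using assms unfolding ind_normality_def by blast
  then show ?thesis
    by (rule ind_mono) (use assms small_subset_Un small_model_small_subset in auto)
qed

lemma ind_base_mono:
  assumes "ind A M B" "small_model K C M" "small_model K C N" "small_subset C A" "small_subset C B"
    "uni M \<subseteq> uni N" "uni N \<subseteq> B"
  shows "ind A N B"
proof -
  have "ind_base_monotonicity K C ind" using independence by (simp add: independence_relation_def)
  moreover have "leK K M N" using assms leK_iff by simp
  ultimately show ?thesis using assms unfolding ind_base_monotonicity_def by blast
qed

lemma ind_trans: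
  assumes "ind A M (uni N)" "ind A N B" "small_model K C M" "small_model K C N"
    "small_subset C A" "small_subset C B" "uni M \<subseteq> uni N"
  shows "ind A M B"
proof -
  have "ind_transitivity K C ind" using independence by (simp add: independence_relation_def)
  moreover have "leK K M N" using assms leK_iff by simp
  ultimately show ?thesis using assms unfolding ind_transitivity_def by blast
qed

lemma ind_aut_iff:
  assumes h: "aut h" and M: "small_model K C M" and A: "small_subset C A" and B: "small_subset C B"
  shows "ind (h ` A) (aut_model h M) (h ` B) \<longleftrightarrow> ind A M B"
proof
  let ?g = "aut_inv h"
  assume "ind (h ` A) (aut_model h M) (h ` B)"
  then have "ind (?g ` h ` A) (aut_model ?g (aut_model h M)) (?g ` h ` B)"
    by (rule ind_aut[OF aut_aut_inv[OF h] small_model_aut_model[OF h M]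
          small_subset_aut_image[OF h A] small_subset_aut_image[OF h B]])
  moreover have "aut_model ?g (aut_model h M) = M"
    by (rule aut_model_eq[OF M]) (simp add: aut_inv_image[OF h small_model_uni[OF M]])
  moreover have "A \<subseteq> uni C" "B \<subseteq> uni C" using A B by (auto simp: small_subset_def)
  ultimately show "ind A M B" using aut_inv_image[OF h] by metis
qed (rule ind_aut[OF assms])

lemma ind_aut_fixing_iff:
  assumes "aut h" "\<forall>a\<in>uni M. h a = a" "small_model K C M" "small_subset C A" "small_subset C B"
  shows "ind (h ` A) M (h ` B) \<longleftrightarrow> ind A M B"
  using ind_aut_iff[OF assms(1,3-5)] aut_model_fixed[OF assms(3,2)] by simp

lemma nonforking_gtp_iff:
  fixes t :: "'i \<Rightarrow> 'a option"
  assumes "small_model K C M" "small_subset C B" "uni M \<subseteq> B" "small_subset C (ran t)"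
  shows "nonforking K C ind (gtp K C t B) B M \<longleftrightarrow> ind (ran t) M B"
proof
  assume "nonforking K C ind (gtp K C t B) B M"
  then obtain b where b: "gtp K C t B = gtp K C b B" "ind (ran b) M B"
    by (auto simp: nonforking_def)
  have "B \<subseteq> uni C" "ran t \<subseteq> uni C" using assms by (auto simp: small_subset_def)
  from b(1)[unfolded gtp_eq_iff[OF this]]
  obtain h where h: "aut h" "\<forall>a\<in>B. h a = a" "b = map_option h \<circ> t" by blast
  have "h ` B = B" using h(2) by force
  then have "ind (h ` ran t) M (h ` B)" using b(2) h(3) by (simp add: ran_map_option_comp)
  then show "ind (ran t) M B"
    using ind_aut_fixing_iff[OF h(1) _ assms(1,4,2)] h(2) assms(3) by blast
qed (auto simp: nonforking_def)

abbreviation tp :: "'a \<Rightarrow> ('f, 'r, 'a) struc \<Rightarrow> ('o \<Rightarrow> 'a option) set" where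
  "tp b M \<equiv> gtp K C (point b) (uni M)"

lemma tp_eq_iff:
  assumes "small_model K C M" "b \<in> uni C"
  shows "tp b M = tp c M \<longleftrightarrow>
    (\<exists>h. aut h \<and> (\<forall>a\<in>uni M. h a = a) \<and> c = h b)"
  using gtp_eq_iff[OF small_model_uni[OF assms(1)], of "point b" "point c"] assms(2)
  by (simp add: map_option_point)

lemma grestrict_tp:
  assumes "uni M \<subseteq> uni N" "small_model K C N" "b \<in> uni C"
  shows "grestrict K C (tp b N) (uni M) = tp b M"
  by (rule grestrict_gtp) (use assms small_model_uni in auto)

lemma tp_aut_model:
  assumes eq: "tp b M = tp c M"
    and f: "aut f" and M: "small_model K C M" and b: "b \<in> uni C"
  shows "(tp (f b) (aut_model f M)) = tp (f c) (aut_model f M)"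
proof -
  obtain h where h: "aut h" "\<forall>a\<in>uni M. h a = a" "c = h b" using eq tp_eq_iff[OF M b] by blast
  let ?g = "f \<circ> h \<circ> aut_inv f"
  have "aut ?g" using f h(1) aut_comp aut_aut_inv by blast
  moreover have "\<forall>a\<in>uni (aut_model f M). ?g a = a"
    using h(2) aut_inv_left[OF f] small_model_uni[OF M] by auto
  moreover have "f c = ?g (f b)" using aut_inv_left[OF f b] h(3) by simp
  ultimately show ?thesis
    using tp_eq_iff[OF small_model_aut_model[OF f M] aut_in[OF f b]] by blast
qed

lemma nonforking_tp_iff:
  assumes "small_model K C M" "small_model K C N" "uni M \<subseteq> uni N" "b \<in> uni C"
  shows "nonforking K C ind (tp b N) (uni N) M \<longleftrightarrow> ind {b} M (uni N)"
  using nonforking_gtp_iff[OF assms(1) small_model_small_subset[OF assms(2)] assms(3), of "point b"]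
    small_subset_singleton[OF assms(4)] by simp

lemma card_of_subset_less_ordinals: "|A :: 'a set| <o |UNIV :: 'o set|"
proof -
  have "|A| \<le>o |UNIV :: 'a set|" by (simp add: card_of_mono1)
  moreover have "|UNIV :: 'a set| <o |UNIV :: 'a set set|" using card_of_Pow[of UNIV] by simp
  ultimately show ?thesis
    using many_ordinals by (meson ordLeq_ordLess_trans ordLess_transitive)
qed

lemma nat_less_ordinals: "|UNIV :: nat set| <o |UNIV :: 'o set|"
proof (rule ordLeq_ordLess_trans)
  show "|UNIV :: nat set| \<le>o |uni C|"
    using infinite_monster by (simp add: infinite_iff_card_of_nat)
qed (rule card_of_subset_less_ordinals)

lemma infinite_ordinals: "infinite (UNIV :: 'o set)"
  unfolding infinite_iff_card_of_nat by (rule ordLess_imp_ordLeq[OF nat_less_ordinals])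

lemma gS1_iff: "p \<in> gS1 K C A \<longleftrightarrow> (\<exists>b\<in>uni C. p = gtp K C (point b :: 'o \<Rightarrow> 'a option) A)"
proof -
  have "\<exists>x y :: 'o. x \<noteq> y"
    using infinite_ordinals by (metis (full_types) UNIV_eq_I finite.simps insertI1)
  from dom_ord_one_iff_point[OF this]
  have "dom b = {..<ord_one} \<and> ran b \<subseteq> uni C \<longleftrightarrow> (\<exists>a\<in>uni C. b = point a)"
    for b :: "'o \<Rightarrow> 'a option"
    by (metis empty_subsetI insert_subset ran_point)
  then show ?thesis by (auto simp: gS_def)
qed

lemma tp_in_gS1: "b \<in> uni C \<Longrightarrow> tp b M \<in> gS1 K C (uni M)"
  using gS1_iff by blast

lemma enumerate_small:
  assumes T: "small_subset C T"
  obtains t :: "'o \<Rightarrow> 'a option" where "ran t = T" "\<And>A. gtp K C t A \<in> gS_all K C A"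
proof -
  obtain \<alpha> :: 'o and t where t: "dom t = {..<\<alpha>}" "ran t = T" "|{..<\<alpha>}| =o |T|"
    using enumerate_by_ordinal[OF card_of_subset_less_ordinals] by metis
  have "small C {..<\<alpha>}"
    using T t(3) unfolding small_def small_subset_def by (meson ordIso_ordLess_trans)
  moreover have "gtp K C t A \<in> gS K C \<alpha> A" for A
    using t T by (auto simp: gS_def small_subset_def)
  ultimately show ?thesis using that[OF t(2)] by (auto simp: gS_all_def)
qed

lemma nonforking_extension_conjugate:
  assumes q: "q \<in> gS_all K C B" "grestrict K C q A = gtp K C t A" "nonforking K C ind q B M"
    and AB: "A \<subseteq> B" "B \<subseteq> uni C" and t: "ran t \<subseteq> uni C"
  obtains h where "aut h" "\<forall>a\<in>A. h a = a" "ind (h ` ran t) M B"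
proof -
  obtain b where b: "q = gtp K C b B" "ind (ran b) M B" using q(3) by (auto simp: nonforking_def)
  have "gtp K C t A = gtp K C b A"
    using q(1,2) grestrict_gtp[OF AB] gS_all_ran unfolding b(1) by metis
  then obtain h where h: "aut h" "\<forall>a\<in>A. h a = a" "b = map_option h \<circ> t"
    using gtp_eq_iff[OF order_trans[OF AB] t] by blast
  with b(2) show ?thesis using that by (simp add: ran_map_option_comp)
qed

lemma ind_base:
  assumes T: "small_subset C T" and M: "small_model K C M"
  shows "ind T M (uni M)"
proof -
  obtain t :: "'o \<Rightarrow> 'a option" where t: "ran t = T" "\<And>A. gtp K C t A \<in> gS_all K C A"
    using enumerate_small[OF T] by metis
  have TC: "ran t \<subseteq> uni C" using T t(1) by (simp add: small_subset_def)
  have "ind_existence ord K C ind" using independence by (simp add: independence_relation_def)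
  moreover have "leK K M M" using leK_iff[OF M M] by simp
  ultimately obtain q where q: "q \<in> gS_all K C (uni M)"
      "grestrict K C q (uni M) = gtp K C t (uni M)" "nonforking K C ind q (uni M) M"
    using M t(2) unfolding ind_existence_def by blast
  obtain h where h: "aut h" "\<forall>a\<in>uni M. h a = a" "ind (h ` ran t) M (uni M)"
    using nonforking_extension_conjugate[OF q subset_refl small_model_uni[OF M] TC] .
  have "h ` uni M = uni M" using h(2) by force
  then show ?thesis
    using ind_aut_fixing_iff[OF h(1,2) M T small_model_small_subset[OF M]] h(3) t(1) by simp
qed

end

locale aec_simple_independence = aec_independence K C ord ind
  for K :: "('f, 'r, 'a) aclass" and C :: "('f, 'r, 'a) struc"
    and ord :: "'o::wellorder itself" and ind :: "('f, 'r, 'a) indep" +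
  assumes symmetry: "ind_symmetry K C ind"
    and type_amalgamation: "ind_type_amalgamation ord K C ind"
begin

lemma ind_sym:
  assumes "ind A M B" "small_model K C M" "small_subset C A" "small_subset C B"
  shows "ind B M A"
  using symmetry assms unfolding ind_symmetry_def by blast

text \<open>Existence only extends types over models; to extend one over \<open>A\<close>, amalgamate it with its own
  restriction to \<open>M\<close>.\<close>

lemma exists_independent_conjugate:
  assumes M: "small_model K C M" and T: "small_subset C T" and A: "small_subset C A"
    and MA: "uni M \<subseteq> A" and ind: "ind T M A" and N: "small_model K C N" and AN: "A \<subseteq> uni N"
  obtains h where "aut h" "\<forall>a\<in>A. h a = a" "ind (h ` T) M (uni N)"
proof -
  obtain t :: "'o \<Rightarrow> 'a option" where t: "ran t = T" "\<And>A. gtp K C t A \<in> gS_all K C A"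
    using enumerate_small[OF T] by metis
  have AC: "A \<subseteq> uni C" and TC: "ran t \<subseteq> uni C" using A T t(1) by (auto simp: small_subset_def)
  note MC = small_model_small_subset[OF M]
  have "nonforking K C ind (gtp K C t A) A M"
    using nonforking_gtp_iff[OF M A MA, of t] t(1) T ind by simp
  moreover have "nonforking K C ind (gtp K C t (uni M)) (uni M) M"
    using nonforking_gtp_iff[OF M MC subset_refl, of t] t(1) T ind_base[OF T M] by simp
  moreover have "grestrict K C (gtp K C t A) (uni M) = gtp K C t (uni M)"
    "grestrict K C (gtp K C t (uni M)) (uni M) = gtp K C t (uni M)"
    using grestrict_gtp[OF _ _ TC] MA AC small_model_uni[OF M] by auto
  moreover have "A \<union> uni M \<subseteq> uni N" using MA AN by auto
  ultimately obtain q where q: "q \<in> gS_all K C (uni N)" "grestrict K C q A = gtp K C t A"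
      "nonforking K C ind q (uni N) M"
    using type_amalgamation M A MC N t(2) MA subset_refl ind_base[OF A M]
    unfolding ind_type_amalgamation_def by meson
  show ?thesis
    using nonforking_extension_conjugate[OF q AN small_model_uni[OF N] TC] that t(1) by blast
qed

lemma exists_independent_model:
  assumes M: "small_model K C M" and T: "small_subset C T" and A: "small_subset C A" "|A| \<le>o |S|"
    and MA: "uni M \<subseteq> A" and ind: "ind T M A" and S: "small_subset C S" "LS K \<le>o |S|"
  obtains N where "small_model K C N" "A \<subseteq> uni N" "|uni N| =o |S|" "ind T M (uni N)"
proof -
  obtain N where N: "small_model K C N" "A \<subseteq> uni N" "|uni N| =o |S|"
    using exists_model_of_card[OF A S] .
  obtain h where h: "aut h" "\<forall>a\<in>A. h a = a" "ind (h ` T) M (uni N)"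
    using exists_independent_conjugate[OF M T A(1) MA ind N(1,2)] .
  let ?g = "aut_inv h" and ?N = "aut_model (aut_inv h) N"
  have TC: "T \<subseteq> uni C" and AC: "A \<subseteq> uni C" using T A by (auto simp: small_subset_def)
  have g: "aut ?g" "\<forall>a\<in>A. ?g a = a"
    using aut_aut_inv[OF h(1)] aut_inv_fixes[OF h(1) AC h(2)] by auto
  have "ind (?g ` h ` T) M (?g ` uni N)"
    using ind_aut_fixing_iff[OF g(1) _ M small_subset_aut_image[OF h(1) T]
        small_model_small_subset[OF N(1)]] h(3) g(2) MA by blast
  then have "ind T M (uni ?N)" using aut_inv_image[OF h(1) TC] by simp
  moreover have "A \<subseteq> uni ?N" using N(2) g(2) by force
  moreover have "|uni ?N| =o |S|"
    by (rule ordIso_transitive[OF card_of_aut_model[OF g(1) N(1)] N(3)])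
  ultimately show ?thesis using that small_model_aut_model[OF g(1) N(1)] by blast
qed

end

section \<open>The rank\<close>

definition forking_step ::
  "('f, 'r, 'a) aclass \<Rightarrow> ('f, 'r, 'a) struc \<Rightarrow> ('f, 'r, 'a) indep \<Rightarrow>
     ('f, 'r, 'a) struc \<Rightarrow> ('o::wellorder \<Rightarrow> 'a option) set \<Rightarrow>
     ('f, 'r, 'a) struc \<Rightarrow> ('o \<Rightarrow> 'a option) set \<Rightarrow> bool" where
  "forking_step K C ind M p M' p' \<longleftrightarrow>
     small_model K C M' \<and> |uni M'| =o |uni M| \<and> forking_extension K C ind M p M' p'"

lemma U_ge_succ_iff:
  assumes "is_succ \<beta> \<alpha>"
  shows "U_ge K C ind M p \<alpha> \<longleftrightarrow>
    (\<exists>M' p'. forking_step K C ind M p M' p' \<and> U_ge K C ind M' p' \<beta>)"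
proof
  assume "U_ge K C ind M p \<alpha>"
  then show "\<exists>M' p'. forking_step K C ind M p M' p' \<and> U_ge K C ind M' p' \<beta>"
  proof cases
    case (succ \<gamma> M' p')
    then show ?thesis using is_succ_unique[OF assms] unfolding forking_step_def by blast
  qed (use assms is_succ_not_zero in \<open>auto simp: is_limit_def\<close>)
qed (use assms U_ge.succ in \<open>auto simp: forking_step_def\<close>)

lemma U_ge_limit_iff:
  assumes "is_limit \<alpha>"
  shows "U_ge K C ind M p \<alpha> \<longleftrightarrow> (\<forall>\<beta><\<alpha>. U_ge K C ind M p \<beta>)"
proof
  assume "U_ge K C ind M p \<alpha>"
  then show "\<forall>\<beta><\<alpha>. U_ge K C ind M p \<beta>" by cases (use assms in \<open>auto simp: is_limit_def\<close>)
qed (use assms U_ge.limit in blast)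

lemma U_ge_antimono:
  assumes "U_ge K C ind M p \<alpha>" "\<beta> \<le> \<alpha>"
  shows "U_ge K C ind M p \<beta>"
  using assms
proof (induction \<beta> arbitrary: M p \<alpha> rule: ordinal_induct)
  case (zero \<beta>)
  then show ?case by (intro U_ge.zero)
next
  case (limit \<beta>)
  then show ?case unfolding U_ge_limit_iff[OF limit.hyps] by (meson less_imp_le order_trans)
next
  case (succ \<delta> \<beta>)
  show ?case
  proof (cases \<alpha> rule: ordinal_cases)
    case zero
    then have "is_zero \<beta>" using \<open>\<beta> \<le> \<alpha>\<close> order_trans unfolding is_zero_def by blast
    then show ?thesis by (rule U_ge.zero)
  next
    case limit
    then show ?thesis using succ.prems U_ge_limit_iff[OF limit] by (metis le_less)
  next
    case (succ \<gamma>)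
    obtain M' p' where p': "forking_step K C ind M p M' p'" "U_ge K C ind M' p' \<gamma>"
      using \<open>U_ge K C ind M p \<alpha>\<close> U_ge_succ_iff[OF succ] by blast
    have "\<delta> < \<alpha>" using \<open>is_succ \<delta> \<beta>\<close> \<open>\<beta> \<le> \<alpha>\<close> by (auto simp: is_succ_def)
    then have "\<delta> \<le> \<gamma>" using is_succ_less_iff[OF succ] by blast
    then have "U_ge K C ind M' p' \<delta>" by (rule succ.IH[OF p'(2)])
    then show ?thesis using p'(1) U_ge_succ_iff[OF \<open>is_succ \<delta> \<beta>\<close>] by blast
  qed
qed

lemma U_infinite_coinduct:
  assumes "P M p"
    and step: "\<And>M p. P M p \<Longrightarrow> \<exists>M' p'. forking_step K C ind M p M' p' \<and> P M' p'"
  shows "U_infinite K C ind M p"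
  unfolding U_infinite_def
proof
  fix \<alpha>
  from \<open>P M p\<close> show "U_ge K C ind M p \<alpha>"
  proof (induction \<alpha> arbitrary: M p rule: ordinal_induct)
    case (zero \<alpha>)
    then show ?case by (intro U_ge.zero)
  next
    case (succ \<beta> \<alpha>)
    then show ?case unfolding U_ge_succ_iff[OF succ.hyps] using step by meson
  next
    case (limit \<alpha>)
    then show ?case unfolding U_ge_limit_iff[OF limit.hyps] by blast
  qed
qed

context aec_independence
begin

lemma forking_step_tp_iff:
  assumes M: "small_model K C M" and b: "b \<in> uni C" and c: "c \<in> uni C"
  shows "forking_step K C ind M (tp b M) M' (tp c M') \<longleftrightarrow>
    small_model K C M' \<and> |uni M'| =o |uni M| \<and> uni M \<subseteq> uni M' \<and>
    tp c M = tp b M \<and> \<not> ind {c} M (uni M')"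
proof (cases "small_model K C M' \<and> uni M \<subseteq> uni M'")
  case True
  then show ?thesis
    using assms grestrict_tp[of M M' c] nonforking_tp_iff[of M M' c] leK_iff[of M M']
    by (auto simp: forking_step_def forking_extension_def gS1_iff)
next
  case False
  then show ?thesis using leK_uni by (auto simp: forking_step_def forking_extension_def)
qed

lemma forking_step_tp:
  assumes "forking_step K C ind M p M' (p' :: ('o \<Rightarrow> 'a option) set)"
  obtains b where "b \<in> uni C" "p' = tp b M'"
  using assms that by (auto simp: forking_step_def forking_extension_def gS1_iff)

lemma forking_step_aut:
  assumes step: "forking_step K C ind M (tp b M) M' (tp c M')"
    and M: "small_model K C M" and b: "b \<in> uni C" and c: "c \<in> uni C" and f: "aut f"
  shows "forking_step K C ind (aut_model f M) (tp (f b) (aut_model f M))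
    (aut_model f M') (tp (f c) (aut_model f M'))"
proof -
  from step have M': "small_model K C M'" "|uni M'| =o |uni M|" "uni M \<subseteq> uni M'"
      and tp: "tp c M = tp b M" and forks: "\<not> ind {c} M (uni M')"
    unfolding forking_step_tp_iff[OF M b c] by auto
  have "|uni (aut_model f M')| =o |uni (aut_model f M)|"
    using card_of_aut_model[OF f M] card_of_aut_model[OF f M'(1)] M'(2)
    by (meson ordIso_symmetric ordIso_transitive)
  moreover have "\<not> ind {f c} (aut_model f M) (uni (aut_model f M'))"
    using ind_aut_iff[OF f M small_subset_singleton[OF c] small_model_small_subset[OF M'(1)]] forks
    by simp
  ultimately show ?thesis
    unfolding forking_step_tp_iff[OF small_model_aut_model[OF f M] aut_in[OF f b] aut_in[OF f c]]
    using M'(3) small_model_aut_model[OF f M'(1)] tp_aut_model[OF tp f M c] by auto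
qed

lemma card_of_pairs_less_ordinals: "|UNIV :: ('a set \<times> 'a) set| <o |UNIV :: 'o set|"
proof -
  have inf: "infinite (UNIV :: 'a set set)"
    using infinite_monster finite_subset[OF subset_UNIV] by (metis Finite_Set.finite_set)
  have "|UNIV :: 'a set| \<le>o |UNIV :: 'a set set|"
    using card_of_Pow[of UNIV] ordLess_imp_ordLeq by fastforce
  then have "|(UNIV :: 'a set set) \<times> (UNIV :: 'a set)| \<le>o |UNIV :: 'a set set|"
    using inf by (intro card_of_Sigma_ordLeq_infinite) (auto simp: card_of_mono1)
  then show ?thesis using many_ordinals by (simp add: ordLeq_ordLess_trans)
qed

lemma U_ge_stabilizes:
  obtains \<alpha> \<alpha>' :: 'o where "is_succ \<alpha> \<alpha>'"
    "\<And>M p. small_model K C M \<Longrightarrow> p \<in> gS1 K C (uni M) \<Longrightarrow> U_ge K C ind M p \<alpha> \<Longrightarrow>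
      U_ge K C ind M p \<alpha>'"
proof -
  define Q where "Q \<alpha> = (\<lambda>(A, b). \<exists>M. small_model K C M \<and> uni M = A \<and>
      U_ge K C ind M (tp b M) \<alpha>)" for \<alpha>
  have "Q \<alpha> x" if "Q \<beta> x" "\<alpha> \<le> \<beta>" for \<alpha> \<beta> x
    using that unfolding Q_def by (cases x) (simp, blast intro: U_ge_antimono)
  then obtain \<alpha> \<alpha>' where succ: "is_succ \<alpha> \<alpha>'" and stable: "\<And>x. Q \<alpha> x \<Longrightarrow> Q \<alpha>' x"
    using antimono_stabilizes[OF _ infinite_ordinals card_of_pairs_less_ordinals] by metis
  have "U_ge K C ind M p \<alpha>'"
    if M: "small_model K C M" and p: "p \<in> gS1 K C (uni M)" "U_ge K C ind M p \<alpha>" for M p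
  proof -
    obtain b where b: "p = tp b M" using p(1) gS1_iff by blast
    then have "Q \<alpha> (uni M, b)" using M p(2) by (auto simp: Q_def)
    then have "Q \<alpha>' (uni M, b)" by (rule stable)
    then show ?thesis using M b small_model_eqI by (auto simp: Q_def)
  qed
  with succ show ?thesis by (rule that)
qed

lemma U_infinite_forking_step:
  assumes "U_infinite K C ind M (p :: ('o \<Rightarrow> 'a option) set)"
    and "small_model K C M" "p \<in> gS1 K C (uni M)"
  obtains M' p' where "forking_step K C ind M p M' p'" "U_infinite K C ind M' p'"
proof -
  obtain \<alpha> \<alpha>' :: 'o where succ: "is_succ \<alpha> \<alpha>'"
    and stable: "\<And>M p. small_model K C M \<Longrightarrow> p \<in> gS1 K C (uni M) \<Longrightarrow> U_ge K C ind M p \<alpha> \<Longrightarrow>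
      U_ge K C ind M p \<alpha>'"
    using U_ge_stabilizes by blast
  define P where "P M p \<longleftrightarrow> small_model K C M \<and> p \<in> gS1 K C (uni M) \<and> U_ge K C ind M p \<alpha>"
    for M and p :: "('o \<Rightarrow> 'a option) set"
  have step: "\<exists>M' p'. forking_step K C ind M p M' p' \<and> P M' p'" if "P M p" for M p
  proof -
    have "U_ge K C ind M p \<alpha>'" using stable \<open>P M p\<close> by (simp add: P_def)
    then show ?thesis
      unfolding U_ge_succ_iff[OF succ] P_def
      by (auto simp: forking_step_def forking_extension_def)
  qed
  have "P M p" using assms by (simp add: P_def U_infinite_def)
  then obtain M' p' where "forking_step K C ind M p M' p'" "P M' p'" using step by blast
  moreover have "U_infinite K C ind M' p'"
    using \<open>P M' p'\<close> step by (rule U_infinite_coinduct)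
  ultimately show ?thesis using that by blast
qed

lemma U_infinite_aut:
  assumes inf: "U_infinite K C ind M (tp b M)"
    and M: "small_model K C M" and b: "b \<in> uni C" and f: "aut f"
  shows "U_infinite K C ind (aut_model f M) (tp (f b) (aut_model f M))"
proof -
  define P where "P N q \<longleftrightarrow> (\<exists>M b. small_model K C M \<and> b \<in> uni C \<and>
      U_infinite K C ind M (tp b M) \<and>
      N = aut_model f M \<and> q = tp (f b) (aut_model f M))"
    for N and q :: "('o \<Rightarrow> 'a option) set"
  have "P (aut_model f M) (tp (f b) (aut_model f M))" using assms by (auto simp: P_def)
  then show ?thesis
  proof (rule U_infinite_coinduct)
    fix N and q :: "('o \<Rightarrow> 'a option) set"
    assume "P N q"
    then obtain M b where M: "small_model K C M" and b: "b \<in> uni C"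
        and inf: "U_infinite K C ind M (tp b M)"
        and N: "N = aut_model f M" "q = tp (f b) (aut_model f M)"
      unfolding P_def by blast
    obtain M' p' where step: "forking_step K C ind M (tp b M) M' p'"
        and inf_ext: "U_infinite K C ind M' p'"
      using U_infinite_forking_step[OF inf M tp_in_gS1[OF b]] .
    obtain c where c: "c \<in> uni C" "p' = tp c M'" using forking_step_tp[OF step] .
    have "P (aut_model f M') (tp (f c) (aut_model f M'))"
      using step inf_ext c by (auto simp: P_def forking_step_def)
    then show "\<exists>N' q'. forking_step K C ind N q N' q' \<and> P N' q'"
      using forking_step_aut[OF step[unfolded c(2)] M b c(1) f] N by blast
  qed
qed

lemma U_infinite_forking_step_same_element:
  assumes inf: "U_infinite K C ind M (tp b M)"
    and M: "small_model K C M" and b: "b \<in> uni C"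
  obtains M' where "forking_step K C ind M (tp b M) M' (tp b M')"
    "U_infinite K C ind M' (tp b M')"
proof -
  obtain M' p' where step: "forking_step K C ind M (tp b M) M' p'"
      and inf_ext: "U_infinite K C ind M' p'"
    using U_infinite_forking_step[OF inf M tp_in_gS1[OF b]] .
  obtain c where c: "c \<in> uni C" "p' = tp c M'" using forking_step_tp[OF step] .
  have M': "small_model K C M'" using step by (simp add: forking_step_def)
  have tp: "tp b M = tp c M"
    using step unfolding c(2) forking_step_tp_iff[OF M b c(1)] by simp
  then obtain h where h: "aut h" "\<forall>a\<in>uni M. h a = a" "b = h c"
    using tp_eq_iff[OF M c(1)] by metis
  have "forking_step K C ind M (tp b M) (aut_model h M') (tp b (aut_model h M'))"
    using forking_step_aut[OF step[unfolded c(2) tp] M c(1) c(1) h(1)]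
    unfolding aut_model_fixed[OF M h(2)] h(3)[symmetric] .
  moreover have "U_infinite K C ind (aut_model h M') (tp b (aut_model h M'))"
    using U_infinite_aut[OF inf_ext[unfolded c(2)] M' c(1) h(1)] unfolding h(3)[symmetric] .
  ultimately show ?thesis by (rule that)
qed

lemma U_infinite_forking_chain:
  assumes inf: "U_infinite K C ind M (tp b M)"
    and M: "small_model K C M" and b: "b \<in> uni C"
  obtains N :: "nat \<Rightarrow> ('f, 'r, 'a) struc" where
    "\<And>n. small_model K C (N n)" "\<And>n. |uni (N n)| =o |uni M|"
    "\<And>n. uni (N n) \<subseteq> uni (N (Suc n))" "\<And>n. \<not> ind {b} (N n) (uni (N (Suc n)))"
proof -
  define P where "P N \<longleftrightarrow> small_model K C N \<and> |uni N| =o |uni M| \<and>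
      U_infinite K C ind N (tp b N)" for N
  have "\<exists>N. \<forall>n. P (N n) \<and>
      (uni (N n) \<subseteq> uni (N (Suc n)) \<and> \<not> ind {b} (N n) (uni (N (Suc n))))"
  proof (rule dependent_nat_choice)
    show "\<exists>N. P N" using M inf card_of_refl unfolding P_def by blast
  next
    fix N and n :: nat
    assume "P N"
    then have N: "small_model K C N" "|uni N| =o |uni M|"
        and inf: "U_infinite K C ind N (tp b N)"
      by (auto simp: P_def)
    obtain N' where step: "forking_step K C ind N (tp b N) N' (tp b N')"
        and "U_infinite K C ind N' (tp b N')"
      using U_infinite_forking_step_same_element[OF inf N(1) b] .
    then show "\<exists>N'. P N' \<and> (uni N \<subseteq> uni N' \<and> \<not> ind {b} N (uni N'))"
      using N(2) ordIso_transitive unfolding P_def forking_step_tp_iff[OF N(1) b b] by blast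
  qed
  then show ?thesis using that unfolding P_def by blast
qed

end

section \<open>Supersimplicity\<close>

context aec_monster
begin

lemma continuous_chain_small: "continuous_chain K C \<delta> M \<Longrightarrow> i \<le> \<delta> \<Longrightarrow> small_model K C (M i)"
  by (simp add: continuous_chain_def)

lemma continuous_chain_mono:
  "continuous_chain K C \<delta> M \<Longrightarrow> i \<le> j \<Longrightarrow> j \<le> \<delta> \<Longrightarrow> uni (M i) \<subseteq> uni (M j)"
  unfolding continuous_chain_def using leK_uni by blast

lemma continuous_chain_finite_subset:
  assumes chain: "continuous_chain K C \<delta> M" and \<delta>: "is_limit \<delta>" and i: "i < \<delta>"
    and A: "finite A" "A \<subseteq> uni (M \<delta>)"
  obtains j where "i \<le> j" "j < \<delta>" "A \<subseteq> uni (M j)"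
proof -
  let ?B = "(\<lambda>j. uni (M j)) ` {i..<\<delta>}"
  have "A \<subseteq> \<Union>?B"
  proof
    fix a assume "a \<in> A"
    then obtain j where j: "j < \<delta>" "a \<in> uni (M j)"
      using A(2) chain \<delta> by (auto simp: continuous_chain_def)
    then have "uni (M j) \<subseteq> uni (M (max i j))"
      using continuous_chain_mono[OF chain] i by (simp add: less_imp_le)
    then show "a \<in> \<Union>?B" using i j by fastforce
  qed
  moreover have "subset.chain UNIV ?B"
    using continuous_chain_mono[OF chain] unfolding subset_chain_def
    by (auto simp: le_less_trans) (meson linear less_imp_le subsetD)
  moreover have "?B \<noteq> {}" using i by auto
  ultimately obtain B where "B \<in> ?B" "A \<subseteq> B"
    using finite_subset_Union_chain[OF A(1)] by metis
  then show ?thesis using that by auto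
qed

lemma omega_chain_continuous:
  fixes N :: "nat \<Rightarrow> ('f, 'r, 'a) struc"
  assumes less: "|UNIV :: nat set| <o |UNIV :: 'o::wellorder set|"
    and N: "\<And>n. small_model K C (N n)" and mono: "mono (\<lambda>n. uni (N n))"
    and U: "small_model K C U" "uni U = (\<Union>n. uni (N n))"
  obtains \<delta> :: "'o::wellorder" and F where
    "is_limit \<delta>" "continuous_chain K C \<delta> F" "F \<delta> = U" "\<And>i. i < \<delta> \<Longrightarrow> F i \<in> range N"
proof -
  obtain \<omega> :: 'o and e :: "nat \<Rightarrow> 'o" where e: "strict_mono e" "range e = {..<\<omega>}"
    using exists_omega[OF less] .
  define F where "F i = (if i < \<omega> then N (inv e i) else U)" for i
  have below: "\<exists>n. i = e n" if "i < \<omega>" for i using that e(2) by (metis lessThan_iff rangeE)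
  have F_e: "F (e n) = N n" for n
    using e strict_mono_imp_inj_on[OF e(1)] by (auto simp: F_def)
  have F_\<omega>: "F \<omega> = U" by (simp add: F_def)
  have small_F: "small_model K C (F i)" for i using N U(1) by (simp add: F_def)
  have "uni (F i) \<subseteq> uni (F j)" if "i \<le> j" "j \<le> \<omega>" for i j
  proof (cases "j < \<omega>")
    case True
    then obtain m n where mn: "i = e m" "j = e n" using below \<open>i \<le> j\<close> le_less_trans by metis
    then have "m \<le> n" using \<open>i \<le> j\<close> strict_mono_less_eq[OF e(1)] by simp
    then show ?thesis using mn F_e monoD[OF mono] by simp
  next
    case False
    then show ?thesis using \<open>j \<le> \<omega>\<close> F_\<omega> U(2) by (auto simp: F_def)
  qed
  then have "leK K (F i) (F j)" if "i \<le> j" "j \<le> \<omega>" for i j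
    using leK_iff[OF small_F small_F] that by simp
  moreover have "uni (F \<omega>) = (\<Union>i\<in>{..<\<omega>}. uni (F i))"
    unfolding e(2)[symmetric] using U(2) by (simp add: F_e F_\<omega>)
  then have "uni (F j) = (\<Union>i\<in>{..<j}. uni (F i))" if "j \<le> \<omega>" "is_limit j" for j
    using is_limit_upto_omega_iff[OF e that(1)] that(2) by simp
  ultimately have "continuous_chain K C \<omega> F" by (simp add: continuous_chain_def small_F)
  moreover have "is_limit \<omega>" using is_limit_upto_omega_iff[OF e order_refl] by simp
  moreover have "F i \<in> range N" if "i < \<omega>" for i using that by (simp add: F_def)
  ultimately show ?thesis using that F_\<omega> by blast
qed

end

context aec_independence
begin

lemma finite_local_character_omega:
  assumes flc: "ind_finite_local_character ord K C ind"
    and N: "\<And>n :: nat. small_model K C (N n)" and mono: "mono (\<lambda>n. uni (N n))"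
    and U: "small_model K C U" "uni U = (\<Union>n. uni (N n))" and b: "b \<in> uni C"
  obtains n where "ind {b} (N n) (uni U)"
proof -
  obtain \<delta> :: 'o and F where F: "is_limit \<delta>" "continuous_chain K C \<delta> F" "F \<delta> = U"
      "\<And>i. i < \<delta> \<Longrightarrow> F i \<in> range N"
    using omega_chain_continuous[OF nat_less_ordinals N mono U] by metis
  have "tp b U \<in> gS1 K C (uni (F \<delta>))" using tp_in_gS1[OF b] F(3) by simp
  then obtain i where i: "i < \<delta>"
      "nonforking K C ind (tp b U) (uni (F \<delta>)) (F i)"
    using flc F(1,2) unfolding ind_finite_local_character_def by blast
  then obtain n where "F i = N n" using F(4) by blast
  then have "ind {b} (N n) (uni U)"
    using i(2) F(3) nonforking_tp_iff[OF N U(1) _ b, of n] U(2) by auto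
  then show ?thesis by (rule that)
qed

lemma not_U_infinite_if_finite_local_character:
  assumes flc: "ind_finite_local_character ord K C ind"
    and M: "small_model K C M" and p: "p \<in> gS1 K C (uni M)"
  shows "\<not> U_infinite K C ind M (p :: ('o \<Rightarrow> 'a option) set)"
proof
  assume inf: "U_infinite K C ind M p"
  obtain b where b: "b \<in> uni C" "p = tp b M" using p gS1_iff by blast
  obtain N :: "nat \<Rightarrow> ('f, 'r, 'a) struc" where N: "\<And>n. small_model K C (N n)"
      "\<And>n. |uni (N n)| =o |uni M|" "\<And>n. uni (N n) \<subseteq> uni (N (Suc n))"
      "\<And>n. \<not> ind {b} (N n) (uni (N (Suc n)))"
    using U_infinite_forking_chain[OF inf[unfolded b(2)] M b(1)] by metis
  have mono: "mono (\<lambda>n. uni (N n))" unfolding mono_iff_le_Suc using N(3) by blast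
  have "small_subset C (\<Union>n. uni (N n))"
    using small_subset_UN_nat[OF small_model_uni[OF N(1)] _ small_model_small_subset[OF M]] N(2)
    by (simp add: ordIso_iff_ordLeq)
  then obtain U where U: "small_model K C U" "uni U = (\<Union>n. uni (N n))"
    using exists_union_of_chain[OF N(1) mono] by metis
  obtain n where "ind {b} (N n) (uni U)"
    using finite_local_character_omega[OF flc N(1) mono U b(1)] .
  then have "ind {b} (N n) (uni (N (Suc n)))"
    by (rule ind_mono[OF _ N(1) small_subset_singleton[OF b(1)] small_model_small_subset[OF U(1)]])
      (use U(2) in auto)
  then show False using N(4) by blast
qed

lemma dependent_on_chain_member:
  assumes witness: "finite_witness_property_singletons K C ind"
    and chain: "continuous_chain K C \<delta> M" and \<delta>: "is_limit \<delta>" and i: "i < \<delta>" and b: "b \<in> uni C"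
    and forks: "\<not> ind {b} (M i) (uni (M \<delta>))"
  obtains j where "i \<le> j" "j < \<delta>" "\<not> ind {b} (M i) (uni (M j))"
proof -
  note small = continuous_chain_small[OF chain]
  have "leK K (M i) (M \<delta>)" using chain i by (simp add: continuous_chain_def)
  then obtain A where A: "finite A" "A \<subseteq> uni (M \<delta>)" "\<not> ind {b} (M i) A"
    using witness forks small[of i] small[of \<delta>] i b
    unfolding finite_witness_property_singletons_def by (meson less_imp_le order_refl)
  obtain j where j: "i \<le> j" "j < \<delta>" "A \<subseteq> uni (M j)"
    using continuous_chain_finite_subset[OF chain \<delta> i A(1,2)] .
  have "\<not> ind {b} (M i) (uni (M j))"
    using ind_mono[of "{b}" "M i" "uni (M j)" "{b}" A] A(3) j i small small_model_small_subset
      small_subset_singleton[OF b] by auto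
  with j show ?thesis using that by blast
qed

definition free_extension ::
  "'a set \<Rightarrow> 'a set \<Rightarrow> ('f, 'r, 'a) struc \<Rightarrow> ('f, 'r, 'a) struc \<Rightarrow> bool" where
  "free_extension T S M N \<longleftrightarrow>
     small_model K C N \<and> uni M \<subseteq> uni N \<and> |uni N| =o |S| \<and> ind T M (uni N)"

lemma dependent_over_free_extension:
  assumes free: "free_extension T S M N" and M: "small_model K C M"
    and T: "small_subset C T" "b \<in> T"
    and forks: "\<not> ind {b} M B" and N': "small_model K C N'" "B \<subseteq> uni N'"
  shows "\<not> ind {b} N (uni N')"
proof
  assume NN': "ind {b} N (uni N')"
  have N: "small_model K C N" "uni M \<subseteq> uni N" "ind T M (uni N)"
    using free by (auto simp: free_extension_def)
  have b: "small_subset C {b}" using T small_subset_singleton by (auto simp: small_subset_def)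
  note N'C = small_model_small_subset[OF N'(1)]
  have "ind {b} M (uni N)"
    by (rule ind_mono[OF N(3) M T(1) small_model_small_subset[OF N(1)]]) (use T(2) in auto)
  then have "ind {b} M (uni N')" by (rule ind_trans[OF _ NN' M N(1) b N'C N(2)])
  then have "ind {b} M B" by (rule ind_mono[OF _ M b N'C subset_refl N'(2)])
  with forks show False ..
qed

end

context aec_simple_independence
begin

lemma exists_free_extension:
  assumes M: "small_model K C M" and T: "small_subset C T"
    and S: "small_subset C S" "LS K \<le>o |S|" "|uni M| \<le>o |S|"
  obtains N where "free_extension T S M N"
  using exists_independent_model[OF M T small_model_small_subset[OF M] S(3) subset_refl
      ind_base[OF T M] S(1,2)] that
  unfolding free_extension_def by metis

lemma free_extension_step:
  assumes free: "free_extension T S M N" and M: "small_model K C M" and M': "small_model K C M'"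
    and MM': "uni M \<subseteq> uni M'" and T: "small_subset C T" "uni M' \<subseteq> T"
    and S: "small_subset C S" "LS K \<le>o |S|" "|uni M'| \<le>o |S|"
  obtains N' where "free_extension T S M' N'" "uni N \<subseteq> uni N'"
proof -
  have N: "small_model K C N" "|uni N| =o |S|" "ind T M (uni N)"
    using free by (auto simp: free_extension_def)
  note NC = small_model_small_subset[OF N(1)] and M'C = small_model_small_subset[OF M']
  have "ind (uni N) M T" by (rule ind_sym[OF N(3) M T(1) NC])
  then have "ind (uni N) M' T" by (rule ind_base_mono[OF _ M M' NC T(1) MM' T(2)])
  then have "ind T M' (uni N)" by (rule ind_sym[OF _ M' NC T(1)])
  then have ind: "ind T M' (uni N \<union> uni M')" by (rule ind_Un_base[OF _ M' T(1) NC])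
  have card: "|uni N \<union> uni M'| \<le>o |S|"
    using infinite_if_LS_le[OF S(2)] S(3) N(2)
    by (intro card_of_Un_ordLeq_infinite_Field)
      (auto simp: ordIso_iff_ordLeq Field_card_of card_of_card_order_on)
  obtain N' where "small_model K C N'" "uni N \<union> uni M' \<subseteq> uni N'" "|uni N'| =o |S|"
      "ind T M' (uni N')"
    using exists_independent_model[OF M' T(1) small_subset_Un[OF NC M'C] card Un_upper2 ind
        S(1,2)] .
  then show ?thesis using that by (auto simp: free_extension_def)
qed

lemma forking_chain_free_extension_step:
  assumes witness: "finite_witness_property_singletons K C ind"
    and chain: "continuous_chain K C \<delta> M" and \<delta>: "is_limit (\<delta> :: 'o)"
    and T: "small_subset C T" "b \<in> T" "uni (M \<delta>) \<subseteq> T"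
    and S: "small_subset C S" "LS K \<le>o |S|" "|uni (M \<delta>)| \<le>o |S|"
    and i: "i < \<delta>" and free: "free_extension T S (M i) N"
    and forks: "\<not> ind {b} (M i) (uni (M \<delta>))"
  obtains j N' where "j < \<delta>" "free_extension T S (M j) N'"
    "forking_step K C ind N (tp b N) N' (tp b N')"
proof -
  have b: "b \<in> uni C" using T by (auto simp: small_subset_def)
  obtain j where j: "i \<le> j" "j < \<delta>" "\<not> ind {b} (M i) (uni (M j))"
    using dependent_on_chain_member[OF witness chain \<delta> i b forks] .
  have Mi: "small_model K C (M i)" and Mj: "small_model K C (M j)"
    using continuous_chain_small[OF chain] i j(2) by simp_all
  have Mij: "uni (M i) \<subseteq> uni (M j)" and Mj\<delta>: "uni (M j) \<subseteq> uni (M \<delta>)"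
    using continuous_chain_mono[OF chain] j by simp_all
  obtain N' where N': "free_extension T S (M j) N'" "uni N \<subseteq> uni N'"
    using free_extension_step[OF free Mi Mj Mij T(1) order_trans[OF Mj\<delta> T(3)] S(1,2)
        ordLeq_transitive[OF card_of_mono1[OF Mj\<delta>] S(3)]] .
  have small: "small_model K C N" "small_model K C N'" and "uni (M j) \<subseteq> uni N'"
    using free N'(1) by (auto simp: free_extension_def)
  then have "\<not> ind {b} N (uni N')"
    by (intro dependent_over_free_extension[OF free Mi T(1,2) j(3)])
  moreover have "|uni N'| =o |uni N|"
    using free N'(1) unfolding free_extension_def by (meson ordIso_symmetric ordIso_transitive)
  ultimately have "forking_step K C ind N (tp b N) N' (tp b N')"
    unfolding forking_step_tp_iff[OF small(1) b b] using small(2) N'(2) by simp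
  with j(2) N'(1) show ?thesis by (rule that)
qed

lemma exists_U_infinite_if_forking_chain:
  assumes witness: "finite_witness_property_singletons K C ind"
    and chain: "continuous_chain K C \<delta> M" and \<delta>: "is_limit (\<delta> :: 'o)" and b: "b \<in> uni C"
    and forks: "\<And>i. i < \<delta> \<Longrightarrow> \<not> ind {b} (M i) (uni (M \<delta>))"
  obtains N where "small_model K C N" "U_infinite K C ind N (tp b N)"
proof -
  define T where "T = insert b (uni (M \<delta>))"
  have M\<delta>: "small_subset C (uni (M \<delta>))"
    by (rule small_model_small_subset[OF continuous_chain_small[OF chain order_refl]])
  have T: "small_subset C T" "b \<in> T" "uni (M \<delta>) \<subseteq> T"
    using small_subset_Un[OF small_subset_singleton[OF b] M\<delta>] by (auto simp: T_def)
  obtain S where "uni (M \<delta>) \<subseteq> S" and S: "small_subset C S" "LS K \<le>o |S|"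
    using exists_small_superset_LS_le[OF M\<delta>] .
  then have M\<delta>_le: "|uni (M \<delta>)| \<le>o |S|" by (simp add: card_of_mono1)
  define P where "P N q \<longleftrightarrow> q = tp b N \<and> (\<exists>i<\<delta>. free_extension T S (M i) N)" for N q
  have step: "\<exists>N' q'. forking_step K C ind N q N' q' \<and> P N' q'" if "P N q" for N q
  proof -
    obtain i where q: "q = tp b N" and i: "i < \<delta>" and N: "free_extension T S (M i) N"
      using \<open>P N q\<close> by (auto simp: P_def)
    obtain j N' where "j < \<delta>" "free_extension T S (M j) N'"
        "forking_step K C ind N (tp b N) N' (tp b N')"
      using forking_chain_free_extension_step[OF witness chain \<delta> T S M\<delta>_le i N forks[OF i]] .
    then show ?thesis unfolding P_def q by blast
  qed
  obtain i where i: "i < \<delta>" using \<delta> by (auto simp: is_limit_iff)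
  then have Mi: "small_model K C (M i)" and Mi\<delta>: "uni (M i) \<subseteq> uni (M \<delta>)"
    using continuous_chain_small[OF chain] continuous_chain_mono[OF chain] by simp_all
  obtain N where N: "free_extension T S (M i) N"
    using exists_free_extension[OF Mi T(1) S ordLeq_transitive[OF card_of_mono1[OF Mi\<delta>] M\<delta>_le]] .
  then have "P N (tp b N)" using i by (auto simp: P_def)
  then have "U_infinite K C ind N (tp b N)" using step by (rule U_infinite_coinduct)
  then show ?thesis using that N by (auto simp: free_extension_def)
qed

lemma finite_local_character_if_not_U_infinite:
  assumes witness: "finite_witness_property_singletons K C ind"
    and ranks: "\<And>M (p :: ('o \<Rightarrow> 'a option) set).
      small_model K C M \<Longrightarrow> p \<in> gS1 K C (uni M) \<Longrightarrow> \<not> U_infinite K C ind M p"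
  shows "ind_finite_local_character ord K C ind"
  unfolding ind_finite_local_character_def
proof (intro allI impI, elim conjE, rule ccontr)
  fix \<delta> :: 'o and M and p :: "('o \<Rightarrow> 'a option) set"
  assume \<delta>: "is_limit \<delta>" and chain: "continuous_chain K C \<delta> M"
    and p: "p \<in> gS1 K C (uni (M \<delta>))"
    and forks: "\<not> (\<exists>i<\<delta>. nonforking K C ind p (uni (M \<delta>)) (M i))"
  obtain b where b: "b \<in> uni C" "p = tp b (M \<delta>)" using p gS1_iff by blast
  have "\<not> ind {b} (M i) (uni (M \<delta>))" if "i < \<delta>" for i
    using forks that b nonforking_tp_iff[of "M i" "M \<delta>" b] continuous_chain_small[OF chain]
      continuous_chain_mono[OF chain, of i \<delta>] by auto
  then obtain N where "small_model K C N" "U_infinite K C ind N (tp b N)"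
    using exists_U_infinite_if_forking_chain[OF witness chain \<delta> b(1)] by metis
  then show False using ranks tp_in_gS1[OF b(1)] by blast
qed

end

theorem theorem7p12:
  fixes K :: "('f, 'r, 'a) aclass"
    and C :: "('f, 'r, 'a) struc"
    and ind :: "('f, 'r, 'a) indep"
  assumes "|UNIV :: 'a set set| <o |UNIV :: 'o::wellorder set|"
    and "is_aec K" and "joint_embedding K" and "amalgamation K" and "no_maximal_models K"
    and "monster_model K C"
    and "simple_independence_relation TYPE('o) K C ind"
    and "finite_witness_property_singletons K C ind"
  shows "supersimple_independence_relation TYPE('o) K C ind \<longleftrightarrow>
    (\<forall>M. \<forall>p :: ('o \<Rightarrow> 'a option) set.
       small_model K C M \<and> p \<in> gS1 K C (uni M) \<longrightarrow> \<not> U_infinite K C ind M p)"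
proof -
  interpret aec_simple_independence K C "TYPE('o)" ind
    using assms unfolding simple_independence_relation_def by unfold_locales auto
  show ?thesis
    unfolding supersimple_independence_relation_def
    using assms(7) not_U_infinite_if_finite_local_character
      finite_local_character_if_not_U_infinite[OF assms(8)]
    by blast
qed

end
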